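(* Let $G$ be a finite connected undirected multigraph with vertices $v_1,\dots,v_n$, $q=v_n$. Let $\rho:\operatorname{Jac}(G)^*\to GL(\mathbb{C}^n)$ be $\rho(\chi)=\operatorname{diag}(\chi([v_1-q]),\dots,\chi([v_{n-1}-q]),1)$ and $\Gamma=\operatorname{im}(\rho)$. Regard each $[D]\in\operatorname{Jac}(G)$ as a character of $\Gamma$ via $[D](\rho(\chi))=\chi([D])$. Then: (1) $\{x^E=\prod_{i=1}^nx_i^{E(v_i)}:E\in\mathbb{E}_{[D]}\}$ is a $\mathbb{C}$-basis for the relative invariants $\mathbb{C}[x]^\Gamma_{[D]}$; (2) $\mathbb{C}[x]=\bigoplus_{[D]\in\operatorname{Jac}(G)}\mathbb{C}[x]^\Gamma_{[D]}$; (3) the correspondence $E\mapsto x^E$ for effective divisors $E$ gives a bijection between systems of primary and $[D]$-secondary divisors and systems of monomial primary invariants and $[D]$-relative secondary invariants of $\Gamma$.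
   Context: Divisors on $G$ are vectors in $\mathbb{Z}^n$ indexed by vertices; $\deg D=\sum_iD(v_i)$; $L=\mathrm{Deg}-A$ is the Laplacian matrix; $D\sim D'$ iff $D-D'\in\operatorname{im}_\mathbb{Z}L$; $\operatorname{Jac}(G)$ is degree-$0$ divisors modulo $\operatorname{im}_\mathbb{Z} L$ (a finite abelian group), $[D]$ the class, and $\operatorname{Jac}(G)^*=\operatorname{Hom}(\operatorname{Jac}(G),\mathbb{C}^\times)$. $E$ is effective if all $E(v)\ge0$; $|D|=\{E\ge 0:E\sim D\}$; $\mathbb{E}_{[D]}=\bigcup_{k\ge0}|D+kq|$. $\operatorname{ord}_q(v)$ is the order of $[v-q]$. A system of primary divisors is $\mathcal{P}=\{\ell_vv:v\in V\}$ with each $\ell_v$ a positive multiple of $\operatorname{ord}_q(v)$, and the corresponding $[D]$-secondary divisors are $\mathcal{S}_{[D]}=\{E\in\mathbb{E}_{[D]}:E(v)<\ell_v\ \forall v\}$; every $E\in\mathbb{E}_{[D]}$ is uniquely $F+\sum_{P\in\mathcal P}a_PP$ with $F\in\mathcal{S}_{[D]}$, $a_P\in\mathbb{N}$. For $A\in GL(\mathbb{C}^n)$ and $f\in\mathbb{C}[x]=\mathbb{C}[x_1,\dots,x_n]$, $(f\circ A)(x)=f(A\vec x)$. For a character $\chi$ of a finite group $\Gamma\subset GL(\mathbb{C}^n)$, $\mathbb{C}[x]^\Gamma_\chi=\{f: f\circ\gamma=\chi(\gamma)f\ \forall\gamma\in\Gamma\}$; $\mathbb{C}[x]^\Gamma$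 is the case of the trivial character. Primary invariants are algebraically independent homogeneous invariants $p_1,\dots,p_n$ such that $\mathbb{C}[x]^\Gamma$ is a finitely generated free $\mathbb{C}[p_1,\dots,p_n]$-module; $\chi$-relative secondary invariants are homogeneous $q_1,\dots,q_t$ forming a $\mathbb{C}$-basis of $\mathbb{C}[x]^\Gamma_\chi$ modulo $\sum_ip_i\mathbb{C}[x]^\Gamma_\chi$, so that $\mathbb{C}[x]^\Gamma_\chi=\bigoplus_jq_j\mathbb{C}[p_1,\dots,p_n]$. *)

theory Defs
  imports
    "HOL-Analysis.Analysis"
    "HOL-Algebra.Multiplicative_Group"
    "HOL-Library.Multiset"
    "HOL-Library.Uprod"
    "HOL-Library.Poly_Mapping"
begin

section \<open>Divisors on a multigraph\<close>

text \<open>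
  The vertex set is the finite type \<open>'v\<close>, so \<open>n = CARD('v)\<close>; a multigraph is the multiset of its
  edges. Loops are permitted; they contribute 2 to both the degree and the diagonal of the
  adjacency matrix, hence nothing to the Laplacian.
\<close>

type_synonym 'v multigraph = "'v uprod multiset"

type_synonym 'v divisor = "int ^ 'v"

definition connected_multigraph :: "'v::finite multigraph \<Rightarrow> bool" where
  "connected_multigraph G \<longleftrightarrow> (\<forall>u v. (u, v) \<in> {(a, b). Upair a b \<in># G}\<^sup>*)"

definition adjacency :: "'v::finite multigraph \<Rightarrow> int ^ 'v ^ 'v" where
  "adjacency G = (\<chi> u v. (if u = v then 2 else 1) * int (count G (Upair u v)))"

definition degree_matrix :: "'v::finite multigraph \<Rightarrow> int ^ 'v ^ 'v" where
  "degree_matrix G = (\<chi> u v. if u = v then \<Sum>w\<in>UNIV. adjacency G $ u $ w else 0)"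

definition laplacian :: "'v::finite multigraph \<Rightarrow> int ^ 'v ^ 'v" where
  "laplacian G = degree_matrix G - adjacency G"

definition vertex_div :: "'v::finite \<Rightarrow> 'v divisor" where
  "vertex_div v = axis v 1"

definition div_degree :: "'v::finite divisor \<Rightarrow> int" where
  "div_degree D = (\<Sum>v\<in>UNIV. D $ v)"

definition principal :: "'v::finite multigraph \<Rightarrow> 'v divisor set" where
  "principal G = range (\<lambda>f. laplacian G *v f)"

definition lin_equiv :: "'v::finite multigraph \<Rightarrow> 'v divisor \<Rightarrow> 'v divisor \<Rightarrow> bool" where
  "lin_equiv G D D' \<longleftrightarrow> D - D' \<in> principal G"

definition effective :: "'v::finite divisor \<Rightarrow> bool" where
  "effective E \<longleftrightarrow> (\<forall>v. E $ v \<ge> 0)"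

definition linear_system :: "'v::finite multigraph \<Rightarrow> 'v divisor \<Rightarrow> 'v divisor set" where
  "linear_system G D = {E. effective E \<and> lin_equiv G E D}"

definition effective_class :: "'v::finite multigraph \<Rightarrow> 'v \<Rightarrow> 'v divisor \<Rightarrow> 'v divisor set" where
  "effective_class G q D = (\<Union>k::nat. linear_system G (D + int k *s vertex_div q))"


section \<open>The Jacobian group and its dual\<close>

definition Div0 :: "'v::finite divisor monoid" where
  "Div0 = \<lparr>carrier = {D. div_degree D = 0}, monoid.mult = (+), one = 0\<rparr>"

definition Jac :: "'v::finite multigraph \<Rightarrow> 'v divisor set monoid" where
  "Jac G = Div0 Mod principal G"

definition jac_class :: "'v::finite multigraph \<Rightarrow> 'v divisor \<Rightarrow> 'v divisor set" where
  "jac_class G D = principal G #>\<^bsub>Div0\<^esub> D"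

definition complex_units :: "complex monoid" where
  "complex_units = \<lparr>carrier = UNIV - {0}, monoid.mult = (*), one = 1\<rparr>"

text \<open>
  Homomorphisms are only specified on the carrier, so they are taken to be extensional in order
  that distinct elements of the dual are distinct characters.
\<close>

definition jac_dual :: "'v::finite multigraph \<Rightarrow> ('v divisor set \<Rightarrow> complex) set" where
  "jac_dual G = hom (Jac G) complex_units \<inter> extensional (carrier (Jac G))"

definition ord_q :: "'v::finite multigraph \<Rightarrow> 'v \<Rightarrow> 'v \<Rightarrow> nat" where
  "ord_q G q v = group.ord (Jac G) (jac_class G (vertex_div v - vertex_div q))"

definition rho :: "'v::finite multigraph \<Rightarrow> 'v \<Rightarrow> ('v divisor set \<Rightarrow> complex) \<Rightarrow> complex ^ 'v ^ 'v"
  where "rho G q phi = (\<chi> u v. if u = v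
     then (if v = q then 1 else phi (jac_class G (vertex_div v - vertex_div q))) else 0)"

definition Jac_Gamma :: "'v::finite multigraph \<Rightarrow> 'v \<Rightarrow> (complex ^ 'v ^ 'v) set" where
  "Jac_Gamma G q = rho G q ` jac_dual G"

text \<open>
  An element of the Jacobian as a character of \<open>Jac_Gamma G q\<close>. The map \<open>rho\<close> is injective
  (\<open>inj_on_rho\<close> below), so the preimage is unique and the defining relation holds
  (\<open>jac_char_rho\<close>).
\<close>

definition jac_char ::
    "'v::finite multigraph \<Rightarrow> 'v \<Rightarrow> 'v divisor set \<Rightarrow> complex ^ 'v ^ 'v \<Rightarrow> complex" where
  "jac_char G q c g = inv_into (jac_dual G) (rho G q) g c"


section \<open>Primary and secondary divisors\<close>

definition primary_multiplicities :: "'v::finite multigraph \<Rightarrow> 'v \<Rightarrow> ('v \<Rightarrow> nat) \<Rightarrow> bool" where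
  "primary_multiplicities G q l \<longleftrightarrow> (\<forall>v. 0 < l v \<and> ord_q G q v dvd l v)"

definition primary_divisors :: "('v::finite \<Rightarrow> nat) \<Rightarrow> 'v divisor set" where
  "primary_divisors l = range (\<lambda>v. int (l v) *s vertex_div v)"

definition secondary_divisors ::
    "'v::finite multigraph \<Rightarrow> 'v \<Rightarrow> 'v divisor \<Rightarrow> ('v \<Rightarrow> nat) \<Rightarrow> 'v divisor set" where
  "secondary_divisors G q D l = {E \<in> effective_class G q D. \<forall>v. E $ v < int (l v)}"


section \<open>Polynomials\<close>

type_synonym 'v cpoly = "('v \<Rightarrow>\<^sub>0 nat) \<Rightarrow>\<^sub>0 complex"

definition const_poly :: "complex \<Rightarrow> 'v cpoly" where
  "const_poly c = Poly_Mapping.single 0 c"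

definition var_poly :: "'v \<Rightarrow> 'v cpoly" where
  "var_poly v = Poly_Mapping.single (Poly_Mapping.single v 1) 1"

definition scale_poly :: "complex \<Rightarrow> 'v cpoly \<Rightarrow> 'v cpoly" where
  "scale_poly c f = const_poly c * f"

global_interpretation cpoly: vector_space scale_poly
  by unfold_locales
    (simp_all add: scale_poly_def const_poly_def algebra_simps single_add mult_single
      flip: mult.assoc)

definition subst_poly :: "('v::finite \<Rightarrow> 'w cpoly) \<Rightarrow> 'v cpoly \<Rightarrow> 'w cpoly" where
  "subst_poly g f = (\<Sum>m\<in>Poly_Mapping.keys f.
     scale_poly (Poly_Mapping.lookup f m) (\<Prod>v\<in>UNIV. g v ^ Poly_Mapping.lookup m v))"

definition compose_matrix :: "'v::finite cpoly \<Rightarrow> complex ^ 'v ^ 'v \<Rightarrow> 'v cpoly" where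
  "compose_matrix f A = subst_poly (\<lambda>v. \<Sum>w\<in>UNIV. scale_poly (A $ v $ w) (var_poly w)) f"

text \<open>Only meaningful for effective \<open>E\<close>.\<close>

definition div_monomial :: "'v::finite divisor \<Rightarrow> 'v cpoly" where
  "div_monomial E = (\<Prod>v\<in>UNIV. var_poly v ^ nat (E $ v))"

definition monomials :: "'v::finite cpoly set" where
  "monomials = div_monomial ` {E. effective E}"

definition homogeneous_poly :: "'v::finite cpoly \<Rightarrow> bool" where
  "homogeneous_poly f \<longleftrightarrow>
     (\<exists>d. \<forall>m\<in>Poly_Mapping.keys f. (\<Sum>v\<in>UNIV. Poly_Mapping.lookup m v) = d)"


section \<open>Relative invariants\<close>

definition rel_invariants ::
    "(complex ^ 'v ^ 'v) set \<Rightarrow> (complex ^ 'v ^ 'v \<Rightarrow> complex) \<Rightarrow> 'v::finite cpoly set" where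
  "rel_invariants \<Gamma> psi = {f. \<forall>g\<in>\<Gamma>. compose_matrix f g = scale_poly (psi g) f}"

abbreviation invariants :: "(complex ^ 'v ^ 'v) set \<Rightarrow> 'v::finite cpoly set" where
  "invariants \<Gamma> \<equiv> rel_invariants \<Gamma> (\<lambda>_. 1)"

definition alg_independent :: "('v::finite \<Rightarrow> 'v cpoly) \<Rightarrow> bool" where
  "alg_independent p \<longleftrightarrow> (\<forall>f. subst_poly p f = 0 \<longrightarrow> f = 0)"

definition gen_subalgebra :: "('v::finite \<Rightarrow> 'v cpoly) \<Rightarrow> 'v cpoly set" where
  "gen_subalgebra p = range (subst_poly p)"

definition fin_free_module :: "'v::finite cpoly set \<Rightarrow> 'v cpoly set \<Rightarrow> bool" where
  "fin_free_module R M \<longleftrightarrow>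
     (\<exists>B. finite B \<and> B \<subseteq> M \<and> bij_betw (\<lambda>a. \<Sum>b\<in>B. a b * b) (B \<rightarrow>\<^sub>E R) M)"

text \<open>The \<open>n\<close> primary invariants are indexed by the \<open>n\<close> vertices; the order is immaterial.\<close>

definition primary_invariants ::
    "(complex ^ 'v ^ 'v) set \<Rightarrow> ('v::finite \<Rightarrow> 'v cpoly) \<Rightarrow> bool" where
  "primary_invariants \<Gamma> p \<longleftrightarrow>
     (\<forall>v. homogeneous_poly (p v) \<and> p v \<in> invariants \<Gamma>) \<and>
     alg_independent p \<and>
     fin_free_module (gen_subalgebra p) (invariants \<Gamma>)"

definition basis_modulo :: "'v cpoly set \<Rightarrow> 'v cpoly set \<Rightarrow> 'v cpoly set \<Rightarrow> bool" where
  "basis_modulo Q M W \<longleftrightarrow> finite Q \<and> Q \<subseteq> M \<and>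
     (\<forall>f\<in>M. \<exists>!a. a \<in> (Q \<rightarrow>\<^sub>E UNIV) \<and> f - (\<Sum>b\<in>Q. scale_poly (a b) b) \<in> W)"

definition secondary_invariants ::
    "(complex ^ 'v ^ 'v) set \<Rightarrow> (complex ^ 'v ^ 'v \<Rightarrow> complex) \<Rightarrow>
      ('v::finite \<Rightarrow> 'v cpoly) \<Rightarrow> 'v cpoly set \<Rightarrow> bool" where
  "secondary_invariants \<Gamma> psi p Q \<longleftrightarrow>
     (\<forall>f\<in>Q. homogeneous_poly f) \<and>
     basis_modulo Q (rel_invariants \<Gamma> psi)
       {\<Sum>v\<in>UNIV. p v * h v | h. \<forall>v. h v \<in> rel_invariants \<Gamma> psi}"


section \<open>The Jacobian acts as characters\<close>

lemma comm_group_Div0: "comm_group (Div0 :: 'v::finite divisor monoid)"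
proof (rule comm_groupI)
  fix x :: "'v divisor" assume "x \<in> carrier Div0"
  then show "\<exists>y\<in>carrier Div0. y \<otimes>\<^bsub>Div0\<^esub> x = \<one>\<^bsub>Div0\<^esub>"
    by (intro bexI[of _ "- x"]) (auto simp: Div0_def div_degree_def sum_negf)
qed (auto simp: Div0_def div_degree_def sum.distrib algebra_simps)

lemma adjacency_sym: "adjacency G $ u $ v = adjacency G $ v $ u"
proof -
  have "Upair u v = Upair v u" by simp
  then have "count G (Upair u v) = count G (Upair v u)" by (rule arg_cong)
  moreover have "(u = v) = (v = u)" by (rule eq_commute)
  ultimately show ?thesis unfolding adjacency_def vec_lambda_beta by presburger
qed

lemma degree_laplacian: "div_degree (laplacian G *v f) = 0"
proof -
  have "div_degree (laplacian G *v f) =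
      (\<Sum>u\<in>UNIV. \<Sum>v\<in>UNIV. degree_matrix G $ u $ v * f $ v) -
      (\<Sum>u\<in>UNIV. \<Sum>v\<in>UNIV. adjacency G $ u $ v * f $ v)"
    by (simp add: div_degree_def laplacian_def matrix_vector_mult_def left_diff_distrib
        sum_subtractf)
  also have "(\<Sum>u\<in>UNIV. \<Sum>v\<in>UNIV. degree_matrix G $ u $ v * f $ v) =
      (\<Sum>u\<in>UNIV. (\<Sum>w\<in>UNIV. adjacency G $ u $ w) * f $ u)"
    by (simp add: degree_matrix_def if_distrib[of "\<lambda>x. x * _"] cong: if_cong)
  also have "\<dots> = (\<Sum>u\<in>UNIV. \<Sum>v\<in>UNIV. adjacency G $ v $ u * f $ u)"
    by (simp add: sum_distrib_right adjacency_sym)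
  also have "\<dots> = (\<Sum>u\<in>UNIV. \<Sum>v\<in>UNIV. adjacency G $ u $ v * f $ v)"
    by (rule sum.swap)
  finally show ?thesis by simp
qed

lemma normal_principal: "principal G \<lhd> Div0"
proof -
  interpret D: comm_group "Div0 :: 'a divisor monoid" by (rule comm_group_Div0)
  have inv: "inv\<^bsub>Div0\<^esub> x = - x" if "div_degree x = 0" for x :: "'a divisor"
    by (rule D.inv_equality) (use that in \<open>auto simp: Div0_def div_degree_def sum_negf\<close>)
  have "subgroup (principal G) Div0"
  proof (rule D.subgroupI)
    show "principal G \<subseteq> carrier Div0"
      by (auto simp: principal_def Div0_def degree_laplacian)
    show "principal G \<noteq> {}" by (auto simp: principal_def)
    show "inv\<^bsub>Div0\<^esub> a \<in> principal G" if "a \<in> principal G" for a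
    proof -
      from that obtain f where f: "a = laplacian G *v f" by (auto simp: principal_def)
      then have "- a = laplacian G *v (- f)"
        by (simp add: vec_eq_iff matrix_vector_mult_def sum_negf)
      with inv[of a] f show ?thesis by (auto simp: principal_def degree_laplacian)
    qed
    show "a \<otimes>\<^bsub>Div0\<^esub> b \<in> principal G" if "a \<in> principal G" "b \<in> principal G" for a b
      using that by (auto simp: principal_def Div0_def simp flip: matrix_vector_right_distrib)
  qed
  then show ?thesis by (rule D.subgroup_imp_normal)
qed

lemma comm_group_Jac: "comm_group (Jac G)"
  unfolding Jac_def
  using comm_group.abelian_FactGroup[OF comm_group_Div0] normal_principal normal_imp_subgroup
  by blast

lemma carrier_Jac: "carrier (Jac G) = jac_class G ` {D. div_degree D = 0}"
  by (simp add: Jac_def carrier_FactGroup jac_class_def[abs_def]) (simp add: Div0_def)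

lemma jac_class_add:
  assumes "div_degree D = 0" "div_degree D' = 0"
  shows "jac_class G (D + D') = jac_class G D \<otimes>\<^bsub>Jac G\<^esub> jac_class G D'"
  using normal.rcos_sum[OF normal_principal[of G], of D D'] assms
  by (simp add: Jac_def jac_class_def) (simp add: Div0_def)

lemma divisor_decompose:
  fixes D :: "'v::finite divisor"
  assumes "div_degree D = 0"
  shows "D = (\<Sum>v\<in>UNIV. (D $ v) *s (vertex_div v - vertex_div q))"
proof -
  have "(\<Sum>v\<in>UNIV. (D $ v) * ((if v = u then 1 else 0) - c)) = D $ u" for u c
  proof -
    have "(\<Sum>v\<in>UNIV. (D $ v) * ((if v = u then 1 else 0) - c)) =
        (\<Sum>v\<in>UNIV. if v = u then D $ v else 0) - (\<Sum>v\<in>UNIV. D $ v) * c"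
      unfolding sum_distrib_right sum_subtractf[symmetric] by (rule sum.cong) (auto simp: algebra_simps)
    then show ?thesis using assms by (simp add: div_degree_def)
  qed
  moreover have "(vertex_div v - vertex_div q) $ u = (if v = u then 1 else 0) - vertex_div q $ u"
    for u v :: 'v by (auto simp: vertex_div_def axis_def)
  ultimately show ?thesis by (simp only: vec_eq_iff sum_component vector_smult_component) simp
qed

lemma jac_hom_eqI:
  assumes phi: "phi \<in> hom (Jac G) complex_units" and psi: "psi \<in> hom (Jac G) complex_units"
    and eq: "\<And>v. phi (jac_class G (vertex_div v - vertex_div q)) =
                  psi (jac_class G (vertex_div v - vertex_div q))"
    and D: "div_degree D = 0"
  shows "phi (jac_class G D) = psi (jac_class G D)"
proof -
  let ?K = "{D. div_degree D = 0 \<and> phi (jac_class G D) = psi (jac_class G D)}"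
  have mult: "h (jac_class G (A + B)) = h (jac_class G A) * h (jac_class G B)"
    if "h \<in> hom (Jac G) complex_units" "div_degree A = 0" "div_degree B = 0" for h A B
    using that hom_mult[OF that(1)] by (simp add: jac_class_add carrier_Jac complex_units_def)
  have nz: "h (jac_class G A) \<noteq> 0"
    if "h \<in> hom (Jac G) complex_units" "div_degree A = 0" for h A
    using that hom_in_carrier[OF that(1), of "jac_class G A"]
    by (auto simp: carrier_Jac complex_units_def)
  have deg_add: "div_degree (A + B) = div_degree A + div_degree B" for A B :: "'a divisor"
    by (simp add: div_degree_def sum.distrib)
  have deg_minus: "div_degree (A - B) = div_degree A - div_degree B" for A B :: "'a divisor"
    by (simp add: div_degree_def sum_subtractf)
  have add: "A + B \<in> ?K" if "A \<in> ?K" "B \<in> ?K" for A B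
    using that by (simp add: mult[OF phi] mult[OF psi] deg_add)
  have zero: "0 \<in> ?K"
  proof -
    have d: "div_degree (0::'a divisor) = 0" by (simp add: div_degree_def)
    show ?thesis using mult[OF phi d d] mult[OF psi d d] nz[OF phi d] nz[OF psi d] d by simp
  qed
  have minus: "A - B \<in> ?K" if "A \<in> ?K" "B \<in> ?K" for A B
  proof -
    have d: "div_degree (A - B) = 0" "div_degree B = 0" using that by (simp_all add: deg_minus)
    show ?thesis using mult[OF phi d] mult[OF psi d] nz[OF phi d(2)] nz[OF psi d(2)] that d by simp
  qed
  have gen: "vertex_div v - vertex_div q \<in> ?K" for v
    using eq[of v] by (simp add: deg_minus) (simp add: div_degree_def vertex_div_def axis_def)
  have smult: "k *s A \<in> ?K" if "A \<in> ?K" for A and k :: int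
  proof (induction k rule: int_induct[where k = 0])
    case base
    then show ?case using zero by simp
  next
    case (step1 i)
    have "(i + 1) *s A = i *s A + A" by (simp add: vec_eq_iff algebra_simps)
    then show ?case using add[OF step1(2) that] by (simp only:)
  next
    case (step2 i)
    have "(i - 1) *s A = i *s A - A" by (simp add: vec_eq_iff algebra_simps)
    then show ?case using minus[OF step2(2) that] by (simp only:)
  qed
  have "(\<Sum>v\<in>S. (D $ v) *s (vertex_div v - vertex_div q)) \<in> ?K" for S
    using finite[of S]
  proof (induction S rule: finite_induct)
    case empty
    then show ?case using zero by simp
  next
    case (insert x F)
    show ?case unfolding sum.insert[OF insert.hyps] by (rule add[OF smult[OF gen] insert.IH])
  qed
  from this[of UNIV] divisor_decompose[OF D, of q] show ?thesis by simp
qed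

lemma inj_on_rho: "inj_on (rho G q) (jac_dual G)"
proof (rule inj_onI)
  fix phi psi assume phi: "phi \<in> jac_dual G" and psi: "psi \<in> jac_dual G"
    and eq: "rho G q phi = rho G q psi"
  have hom: "phi \<in> hom (Jac G) complex_units" "psi \<in> hom (Jac G) complex_units"
    using phi psi by (auto simp: jac_dual_def)
  interpret J: comm_group "Jac G" by (rule comm_group_Jac)
  have one: "h (jac_class G 0) = 1" if "h \<in> hom (Jac G) complex_units" for h
  proof -
    have d: "div_degree (0::'a divisor) = 0" by (simp add: div_degree_def)
    have "jac_class G 0 \<in> carrier (Jac G)" using d by (auto simp: carrier_Jac)
    moreover have "jac_class G 0 = jac_class G 0 \<otimes>\<^bsub>Jac G\<^esub> jac_class G 0"
      using jac_class_add[OF d d, of G] by simp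
    ultimately have "h (jac_class G 0) = h (jac_class G 0) * h (jac_class G 0)"
        "h (jac_class G 0) \<noteq> 0"
      using hom_mult[OF that, of "jac_class G 0" "jac_class G 0"]
        hom_in_carrier[OF that, of "jac_class G 0"]
      by (auto simp: complex_units_def)
    then show ?thesis by simp
  qed
  have "phi (jac_class G (vertex_div v - vertex_div q)) =
        psi (jac_class G (vertex_div v - vertex_div q))" for v
  proof (cases "v = q")
    case True
    then show ?thesis using one[OF hom(1)] one[OF hom(2)] by simp
  next
    case False
    have "rho G q phi $ v $ v = rho G q psi $ v $ v" using eq by simp
    with False show ?thesis by (simp add: rho_def)
  qed
  from jac_hom_eqI[OF hom this] have "phi c = psi c" if "c \<in> carrier (Jac G)" for c
    using that by (auto simp: carrier_Jac)
  then show "phi = psi"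
    using phi psi by (intro extensionalityI[of _ "carrier (Jac G)"]) (auto simp: jac_dual_def)
qed

lemma jac_char_rho: "phi \<in> jac_dual G \<Longrightarrow> jac_char G q c (rho G q phi) = phi c"
  by (simp add: jac_char_def inv_into_f_f[OF inj_on_rho])

end

theory Submission
  imports Defs
begin

text \<open>
  A diagonal matrix maps each monomial to a multiple of itself, and \<open>rho(chi)\<close> multiplies \<open>x^m\<close>
  by the value of \<open>chi\<close> at the class of \<open>m - deg(m) q\<close>. Since the characters of the Jacobian
  separate its points, the relative invariants for \<open>[D]\<close> are exactly the polynomials whose monomials
  all lie in the class \<open>[D]\<close>; parts (1) and (2) follow. To separate points one uses the characters
  \<open>D \<mapsto> exp(2 pi i \<langle>y, D\<rangle>)\<close>, where \<open>y\<close> is a real solution of \<open>L y = u - q\<close>.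

  For (3), pure powers \<open>x_v^l_v\<close> with \<open>ord_q(v)\<close> dividing \<open>l_v\<close> are primary invariants by division
  with remainder in every exponent. Conversely, if the invariants are finitely generated over the
  algebra generated by \<open>n\<close> monomials, then a pure power of every variable must occur among these, so
  they are pure powers of the \<open>n\<close> variables. Modulo such primary invariants, a basis of monomials
  has to consist of all the monomials in the class that no primary invariant divides.
\<close>

abbreviation lookup :: "('a \<Rightarrow>\<^sub>0 'b::zero) \<Rightarrow> 'a \<Rightarrow> 'b" where
  "lookup \<equiv> Poly_Mapping.lookup"

abbreviation keys :: "('a \<Rightarrow>\<^sub>0 'b::zero) \<Rightarrow> 'a set" where
  "keys \<equiv> Poly_Mapping.keys"

abbreviation single :: "'a \<Rightarrow> 'b \<Rightarrow> 'a \<Rightarrow>\<^sub>0 'b::zero" where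
  "single \<equiv> Poly_Mapping.single"

abbreviation monomial :: "'a \<Rightarrow> 'a \<Rightarrow>\<^sub>0 'b::zero_neq_one" where
  "monomial m \<equiv> single m 1"

subsection \<open>Divisors and their classes\<close>

global_interpretation divisor: Modules.module "(*s) :: int \<Rightarrow> 'v::finite divisor \<Rightarrow> 'v divisor"
  by unfold_locales simp_all

lemma div_degree_add: "div_degree (D + E) = div_degree D + div_degree E"
  by (simp add: div_degree_def sum.distrib)

lemma div_degree_diff: "div_degree (D - E) = div_degree D - div_degree E"
  by (simp add: div_degree_def sum_subtractf)

lemma div_degree_smult: "div_degree (k *s D) = k * div_degree D"
  by (simp add: div_degree_def sum_distrib_left)

lemma div_degree_vertex_div [simp]: "div_degree (vertex_div v) = 1"
  by (simp add: div_degree_def vertex_div_def axis_def)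

lemma div_degree_principal: "A \<in> principal G \<Longrightarrow> div_degree A = 0"
  by (auto simp: principal_def degree_laplacian)

lemma subspace_principal: "divisor.subspace (principal G)"
proof (rule divisor.subspaceI)
  fix k A B assume "A \<in> principal G" "B \<in> principal G"
  then obtain f g where AB: "A = laplacian G *v f" "B = laplacian G *v g"
    by (auto simp: principal_def)
  have "A + B = laplacian G *v (f + g)"
    by (simp add: AB matrix_vector_right_distrib)
  then show "A + B \<in> principal G" by (auto simp: principal_def)
  have "k *s A = laplacian G *v (k *s f)"
    by (simp add: AB vec_eq_iff matrix_vector_mult_def sum_distrib_left ac_simps)
  then show "k *s A \<in> principal G" by (auto simp: principal_def)
next
  show "0 \<in> principal G" unfolding principal_def by (rule range_eqI[of _ _ 0]) simp
qed

lemma jac_class_eq_image: "jac_class G D = (\<lambda>P. P + D) ` principal G"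
  by (auto simp: jac_class_def r_coset_def Div0_def)

lemma jac_class_eq_iff: "jac_class G D = jac_class G E \<longleftrightarrow> D - E \<in> principal G"
proof
  assume "jac_class G D = jac_class G E"
  moreover have "D \<in> jac_class G D"
    using divisor.subspace_0[OF subspace_principal[of G]] by (force simp: jac_class_eq_image)
  ultimately show "D - E \<in> principal G" by (auto simp: jac_class_eq_image)
next
  assume diff_principal: "D - E \<in> principal G"
  have "jac_class G A \<subseteq> jac_class G B" if "A - B \<in> principal G" for A B
    using divisor.subspace_add[OF subspace_principal _ that]
    by (force simp: jac_class_eq_image algebra_simps image_iff)
  from this[OF diff_principal] this[of E D] show "jac_class G D = jac_class G E"
    using divisor.subspace_neg[OF subspace_principal diff_principal] by simp
qed

lemma jac_class_in_carrier [intro]: "div_degree D = 0 \<Longrightarrow> jac_class G D \<in> carrier (Jac G)"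
  by (auto simp: carrier_Jac)

lemma jac_class_zero: "jac_class G 0 = \<one>\<^bsub>Jac G\<^esub>"
  by (simp add: jac_class_eq_image Jac_def)

lemma mem_effective_class_iff:
  assumes "div_degree D = 0"
  shows "E \<in> effective_class G q D \<longleftrightarrow>
    effective E \<and> jac_class G (E - div_degree E *s vertex_div q) = jac_class G D"
proof
  assume "E \<in> effective_class G q D"
  then obtain k where eff: "effective E" and prin: "E - (D + int k *s vertex_div q) \<in> principal G"
    by (auto simp: effective_class_def linear_system_def lin_equiv_def)
  have "div_degree E = int k"
    using div_degree_principal[OF prin] assms
    by (simp add: div_degree_diff div_degree_add div_degree_smult)
  then show "effective E \<and> jac_class G (E - div_degree E *s vertex_div q) = jac_class G D"
    using eff prin by (simp add: jac_class_eq_iff algebra_simps)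
next
  assume eff_class: "effective E \<and> jac_class G (E - div_degree E *s vertex_div q) = jac_class G D"
  then have "0 \<le> div_degree E" by (simp add: effective_def div_degree_def sum_nonneg)
  then have "E - (D + int (nat (div_degree E)) *s vertex_div q) \<in> principal G"
    using eff_class by (simp add: jac_class_eq_iff algebra_simps)
  then show "E \<in> effective_class G q D"
    using eff_class unfolding effective_class_def linear_system_def lin_equiv_def by blast
qed

subsection \<open>Effective divisors as exponents\<close>

definition exp_divisor :: "('v::finite \<Rightarrow>\<^sub>0 nat) \<Rightarrow> 'v divisor" where
  "exp_divisor m = (\<chi> v. int (lookup m v))"

lemma effective_exp_divisor: "effective (exp_divisor m)"
  by (simp add: effective_def exp_divisor_def)

lemma Collect_effective: "{E. effective E} = range exp_divisor"
proof -
  have "E \<in> range exp_divisor" if "effective E" for E :: "'v::finite divisor"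
  proof
    show "E = exp_divisor (Abs_poly_mapping (\<lambda>v. nat (E $ v)))"
      using that by (simp add: exp_divisor_def effective_def vec_eq_iff)
  qed simp
  then show ?thesis using effective_exp_divisor by auto
qed

lemma exp_divisor_zero: "exp_divisor 0 = 0"
  by (simp add: exp_divisor_def vec_eq_iff)

lemma exp_divisor_add: "exp_divisor (m + k) = exp_divisor m + exp_divisor k"
  by (simp add: exp_divisor_def vec_eq_iff lookup_add)

lemma exp_divisor_single: "exp_divisor (single v k) = int k *s vertex_div v"
  by (auto simp: vec_eq_iff exp_divisor_def vertex_div_def axis_def lookup_single when_def)

abbreviation vertex_class :: "'v::finite multigraph \<Rightarrow> 'v \<Rightarrow> 'v \<Rightarrow> 'v divisor set" where
  "vertex_class G q v \<equiv> jac_class G (vertex_div v - vertex_div q)"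

lemma vertex_class_in_carrier: "vertex_class G q v \<in> carrier (Jac G)"
  by (rule jac_class_in_carrier) (simp add: div_degree_diff)

definition exp_class :: "'v::finite multigraph \<Rightarrow> 'v \<Rightarrow> ('v \<Rightarrow>\<^sub>0 nat) \<Rightarrow> 'v divisor set" where
  "exp_class G q m = jac_class G (exp_divisor m - div_degree (exp_divisor m) *s vertex_div q)"

lemma exp_class_in_carrier [simp]: "exp_class G q m \<in> carrier (Jac G)"
  unfolding exp_class_def
  by (intro jac_class_in_carrier) (simp add: div_degree_diff div_degree_smult)

lemma exp_class_add: "exp_class G q (m + k) = exp_class G q m \<otimes>\<^bsub>Jac G\<^esub> exp_class G q k"
proof -
  let ?D = "\<lambda>m. exp_divisor m - div_degree (exp_divisor m) *s vertex_div q"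
  have "?D (m + k) = ?D m + ?D k"
    by (simp add: exp_divisor_add div_degree_add)
  then show ?thesis
    unfolding exp_class_def
    by (simp only:) (rule jac_class_add; simp add: div_degree_diff div_degree_smult)
qed

lemma exp_class_zero: "exp_class G q 0 = \<one>\<^bsub>Jac G\<^esub>"
  by (simp add: exp_class_def exp_divisor_zero div_degree_def jac_class_zero)

lemma exp_class_single:
  "exp_class G q (single v k) = vertex_class G q v [^]\<^bsub>Jac G\<^esub> k"
proof (induction k)
  case 0
  then show ?case by (simp add: exp_class_zero)
next
  case (Suc k)
  have "exp_class G q (single v (Suc 0)) = vertex_class G q v"
    by (simp add: exp_class_def exp_divisor_single)
  moreover have "single v (Suc k) = single v k + single v (Suc 0)" by (simp flip: single_add)
  ultimately show ?case by (simp add: exp_class_add Suc)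
qed

subsection \<open>The real Laplacian\<close>

definition real_divisor :: "'v::finite divisor \<Rightarrow> real ^ 'v" where
  "real_divisor D = (\<chi> v. real_of_int (D $ v))"

definition real_laplacian :: "'v::finite multigraph \<Rightarrow> real ^ 'v ^ 'v" where
  "real_laplacian G = (\<chi> u v. real_of_int (laplacian G $ u $ v))"

lemma real_divisor_inject: "real_divisor D = real_divisor E \<longleftrightarrow> D = E"
  by (simp add: real_divisor_def vec_eq_iff)

lemma real_divisor_add: "real_divisor (D + E) = real_divisor D + real_divisor E"
  by (simp add: real_divisor_def vec_eq_iff)

lemma real_divisor_diff: "real_divisor (D - E) = real_divisor D - real_divisor E"
  by (simp add: real_divisor_def vec_eq_iff)

lemma sum_real_divisor: "(\<Sum>v\<in>UNIV. real_divisor D $ v) = real_of_int (div_degree D)"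
  by (simp add: real_divisor_def div_degree_def)

lemma real_divisorE:
  assumes "\<And>v. y $ v \<in> \<int>"
  obtains f where "y = real_divisor f"
proof
  show "y = real_divisor (\<chi> v. \<lfloor>y $ v\<rfloor>)"
    using assms by (simp add: real_divisor_def vec_eq_iff)
qed

lemma inner_real_divisor_in_Ints:
  assumes "\<And>v. y $ v \<in> \<int>"
  shows "y \<bullet> real_divisor D \<in> \<int>"
  unfolding inner_vec_def by (intro Ints_sum) (simp add: real_divisor_def assms)

lemma real_laplacian_mult_real_divisor:
  "real_laplacian G *v real_divisor f = real_divisor (laplacian G *v f)"
  by (simp add: vec_eq_iff real_laplacian_def real_divisor_def matrix_vector_mult_def)

lemma principalI_real_laplacian:
  assumes "real_laplacian G *v y = real_divisor D" "\<And>v. y $ v \<in> \<int>"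
  shows "D \<in> principal G"
proof -
  obtain f where "y = real_divisor f" using assms(2) by (rule real_divisorE)
  then have "D = laplacian G *v f"
    using assms(1) by (simp add: real_laplacian_mult_real_divisor real_divisor_inject)
  then show ?thesis by (simp add: principal_def)
qed

lemma real_laplacian_mult_component:
  "(real_laplacian G *v y) $ u = (\<Sum>w\<in>UNIV. real_of_int (adjacency G $ u $ w) * (y $ u - y $ w))"
proof -
  have "(real_laplacian G *v y) $ u =
      (\<Sum>w\<in>UNIV. (if u = w then (\<Sum>x\<in>UNIV. real_of_int (adjacency G $ u $ x)) * y $ w else 0)
         - real_of_int (adjacency G $ u $ w) * y $ w)"
    unfolding matrix_vector_mult_def real_laplacian_def laplacian_def degree_matrix_def
    by (auto intro!: sum.cong simp: algebra_simps)
  then show ?thesis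
    by (simp add: sum_subtractf right_diff_distrib sum_distrib_right)
qed

lemma inner_real_laplacian:
  "y \<bullet> (real_laplacian G *v z) = (real_laplacian G *v y) \<bullet> z"
proof -
  have "laplacian G $ u $ v = laplacian G $ v $ u" for u v
    by (simp add: laplacian_def degree_matrix_def adjacency_sym[of G u v])
  then have "y v* real_laplacian G = real_laplacian G *v y"
    by (simp add: vec_eq_iff vector_matrix_mult_def matrix_vector_mult_def real_laplacian_def
        mult.commute)
  then show ?thesis by (metis dot_lmul_matrix)
qed

lemma sum_real_laplacian_mult: "(\<Sum>u\<in>UNIV. (real_laplacian G *v y) $ u) = 0"
proof -
  have "real_laplacian G *v 1 = 0"
    by (simp add: vec_eq_iff real_laplacian_mult_component)
  then have "1 \<bullet> (real_laplacian G *v y) = 0" by (simp add: inner_real_laplacian)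
  then show ?thesis by (simp add: inner_vec_def)
qed

text \<open>Maximum principle: a harmonic function attains its maximum on a set closed under adjacency.\<close>

lemma real_laplacian_kernel:
  assumes conn: "connected_multigraph G" and harmonic: "real_laplacian G *v y = 0"
  shows "y $ u = y $ v"
proof -
  define M where "M = Max (range (($) y))"
  have le_M: "y $ w \<le> M" for w unfolding M_def by (rule Max_ge) auto
  have "M \<in> range (($) y)" unfolding M_def by (rule Max_in) auto
  then obtain a where a_max: "y $ a = M" by auto
  have adjacent: "y $ c = M" if b_max: "y $ b = M" and edge: "Upair b c \<in># G" for b c
  proof -
    have "(\<Sum>w\<in>UNIV. real_of_int (adjacency G $ b $ w) * (M - y $ w)) = 0"
      using real_laplacian_mult_component[of G y b] harmonic b_max by simp
    then have "real_of_int (adjacency G $ b $ c) * (M - y $ c) = 0"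
      by (subst (asm) sum_nonneg_eq_0_iff) (auto simp: adjacency_def le_M)
    then show ?thesis using edge by (auto simp: adjacency_def count_eq_zero_iff split: if_splits)
  qed
  have "y $ w = M" for w
  proof -
    have "(a, w) \<in> {(a, b). Upair a b \<in># G}\<^sup>*"
      using conn by (auto simp: connected_multigraph_def)
    then show ?thesis by (induction rule: rtrancl_induct) (use a_max adjacent in auto)
  qed
  then show ?thesis by metis
qed

definition grounded_laplacian :: "'v::finite multigraph \<Rightarrow> 'v \<Rightarrow> real ^ 'v ^ 'v" where
  "grounded_laplacian G q = real_laplacian G + (\<chi> u v. if u = q \<and> v = q then 1 else 0)"

lemma grounded_laplacian_mult:
  "grounded_laplacian G q *v y = real_laplacian G *v y + axis q (y $ q)"
proof -
  have "(\<Sum>v\<in>UNIV. (if u = q \<and> v = q then 1 else 0) * y $ v) = axis q (y $ q) $ u" for u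
    by (cases "u = q") (auto simp: axis_def if_distrib[of "\<lambda>x. x * _"] cong: if_cong)
  then show ?thesis
    by (simp add: vec_eq_iff grounded_laplacian_def matrix_vector_mult_def distrib_right
        sum.distrib)
qed

lemma grounded_laplacian_solution:
  assumes "(\<Sum>v\<in>UNIV. b $ v) = 0" "grounded_laplacian G q *v y = b"
  shows "y $ q = 0" "real_laplacian G *v y = b"
proof -
  have "(\<Sum>v\<in>UNIV. (real_laplacian G *v y + axis q (y $ q)) $ v) = 0"
    using assms by (simp add: grounded_laplacian_mult)
  then show yq: "y $ q = 0"
    by (simp add: sum.distrib sum_real_laplacian_mult) (simp add: axis_def)
  show "real_laplacian G *v y = b"
    using assms(2) yq by (simp add: grounded_laplacian_mult) (simp add: axis_def vec_eq_iff)
qed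

lemma det_grounded_laplacian:
  assumes "connected_multigraph G"
  shows "det (grounded_laplacian G q) \<noteq> 0"
proof -
  have "y = 0" if "grounded_laplacian G q *v y = 0" for y
  proof -
    have harmonic: "y $ q = 0" "real_laplacian G *v y = 0"
      using grounded_laplacian_solution[OF _ that] by auto
    have "y $ v = 0" for v
      using real_laplacian_kernel[OF assms harmonic(2), of v q] harmonic(1) by (rule trans)
    then show ?thesis by (simp add: vec_eq_iff)
  qed
  then have "\<exists>B. B ** grounded_laplacian G q = mat 1" by (simp add: matrix_left_invertible_ker)
  then show ?thesis by (simp add: invertible_left_inverse flip: invertible_det_nz)
qed

lemma real_laplacian_preimageE:
  assumes "connected_multigraph G" "(\<Sum>v\<in>UNIV. b $ v) = 0"
  obtains y where "real_laplacian G *v y = b" "y $ q = 0"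
proof -
  obtain y where "grounded_laplacian G q *v y = b"
    using cramer[OF det_grounded_laplacian[OF assms(1), of q]] by blast
  from grounded_laplacian_solution[OF assms(2) this] show ?thesis by (intro that)
qed

subsection \<open>Finiteness of the Jacobian\<close>

lemma det_in_Ints:
  fixes A :: "'a::comm_ring_1 ^ 'n ^ 'n"
  assumes "\<And>i j. A $ i $ j \<in> \<int>"
  shows "det A \<in> \<int>"
  unfolding det_def using assms by (intro Ints_sum Ints_mult Ints_prod) auto

lemma det_mult_component_in_Ints:
  fixes A :: "'a::field ^ 'n ^ 'n"
  assumes "\<And>i j. A $ i $ j \<in> \<int>" "\<And>i. (A *v x) $ i \<in> \<int>"
  shows "det A * x $ k \<in> \<int>"
proof -
  have "det (\<chi> i j. if j = k then (A *v x) $ i else A $ i $ j) \<in> \<int>"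
    by (rule det_in_Ints) (simp add: assms)
  then show ?thesis by (simp add: cramer_lemma mult.commute)
qed

text \<open>By Cramer's rule, the determinant of the grounded Laplacian annihilates the Jacobian.\<close>

lemma exponent_JacE:
  fixes G :: "'v::finite multigraph"
  assumes "connected_multigraph G"
  obtains N :: nat where "0 < N" "\<And>D. div_degree D = 0 \<Longrightarrow> int N *s D \<in> principal G"
proof -
  fix q :: 'v
  let ?A = "grounded_laplacian G q"
  have A_Ints: "?A $ i $ j \<in> \<int>" for i j
    by (simp add: grounded_laplacian_def real_laplacian_def)
  obtain d where det_A: "det ?A = real_of_int d"
    using det_in_Ints[OF A_Ints] by (auto elim: Ints_cases)
  have annihilates: "d *s D \<in> principal G" if deg_D: "div_degree D = 0" for D
  proof -
    obtain y where Ly: "real_laplacian G *v y = real_divisor D" and "y $ q = 0"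
      using real_laplacian_preimageE[OF assms, of "real_divisor D" q] deg_D
      by (auto simp: sum_real_divisor)
    then have "?A *v y = real_divisor D"
      by (simp add: grounded_laplacian_mult vec_eq_iff axis_def)
    then have "det ?A * y $ v \<in> \<int>" for v
      by (intro det_mult_component_in_Ints A_Ints) (simp add: real_divisor_def)
    moreover have "real_laplacian G *v (det ?A *\<^sub>R y) = real_divisor (d *s D)"
      by (simp add: matrix_vector_mult_scaleR Ly det_A) (simp add: real_divisor_def vec_eq_iff)
    ultimately show ?thesis
      by (intro principalI_real_laplacian[where y = "det ?A *\<^sub>R y"]) simp_all
  qed
  show ?thesis
  proof
    show "0 < nat \<bar>d\<bar>" using det_grounded_laplacian[OF assms, of q] det_A by simp
    fix D :: "'v divisor" assume "div_degree D = 0"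
    then have "sgn d *s (d *s D) \<in> principal G"
      by (intro divisor.subspace_scale[OF subspace_principal] annihilates)
    then show "int (nat \<bar>d\<bar>) *s D \<in> principal G" by (simp add: mult.commute flip: abs_sgn)
  qed
qed

definition bounded_exps :: "('v::finite \<Rightarrow> nat) \<Rightarrow> ('v \<Rightarrow>\<^sub>0 nat) set" where
  "bounded_exps l = {m. \<forall>v. lookup m v < l v}"

lemma finite_bounded_exps: "finite (bounded_exps l)"
proof (rule finite_imageD)
  show "finite (lookup ` bounded_exps l)"
    by (rule finite_subset[of _ "Pi\<^sub>E UNIV (\<lambda>v. {..<l v})"])
      (auto simp: bounded_exps_def intro!: finite_PiE)
  show "inj_on lookup (bounded_exps l)"
    by (rule inj_onI) (rule poly_mapping_eq_iff[THEN iffD2])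
qed

lemma finite_carrier_Jac:
  fixes G :: "'v::finite multigraph"
  assumes "connected_multigraph G"
  shows "finite (carrier (Jac G))"
proof -
  fix q :: 'v
  obtain N where N_pos: "0 < N"
    and N_annihilates: "\<And>D. div_degree D = 0 \<Longrightarrow> int N *s D \<in> principal G"
    using exponent_JacE[OF assms] by metis
  have "jac_class G D \<in> exp_class G q ` bounded_exps (\<lambda>_. N)" if deg_D: "div_degree D = 0" for D
  proof
    define m where "m = Abs_poly_mapping (\<lambda>v. nat (D $ v mod int N))"
    define B where "B = (\<chi> v. D $ v div int N)"
    have D_eq: "D = exp_divisor m + int N *s B"
      using N_pos by (simp add: vec_eq_iff exp_divisor_def m_def B_def)
    have "div_degree (exp_divisor m) = - (int N * div_degree B)"
      using deg_D unfolding D_eq by (simp add: div_degree_add div_degree_smult)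
    then have "D - (exp_divisor m - div_degree (exp_divisor m) *s vertex_div q) =
        int N *s (B - div_degree B *s vertex_div q)"
      by (simp add: D_eq)
    also have "\<dots> \<in> principal G"
      by (intro N_annihilates) (simp add: div_degree_diff div_degree_smult)
    finally show "jac_class G D = exp_class G q m" by (simp add: exp_class_def jac_class_eq_iff)
    show "m \<in> bounded_exps (\<lambda>_. N)" using N_pos by (simp add: bounded_exps_def m_def nat_less_iff)
  qed
  then have "carrier (Jac G) \<subseteq> exp_class G q ` bounded_exps (\<lambda>_. N)" by (auto simp: carrier_Jac)
  then show ?thesis by (rule finite_subset) (intro finite_imageI finite_bounded_exps)
qed

lemma ord_q_dvd_iff: "ord_q G q v dvd k \<longleftrightarrow> exp_class G q (single v k) = \<one>\<^bsub>Jac G\<^esub>"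
proof -
  interpret comm_group "Jac G" by (rule comm_group_Jac)
  show ?thesis using pow_eq_id[OF vertex_class_in_carrier] by (simp add: ord_q_def exp_class_single)
qed

lemma ord_q_pos:
  assumes "connected_multigraph G"
  shows "0 < ord_q G q v"
proof -
  interpret comm_group "Jac G" by (rule comm_group_Jac)
  show ?thesis
    using ord_ge_1[OF finite_carrier_Jac[OF assms] vertex_class_in_carrier]
    by (simp add: ord_q_def Suc_le_eq)
qed

subsection \<open>Characters of the Jacobian\<close>

lemma group_complex_units: "group complex_units"
proof (rule groupI)
  show "\<exists>y\<in>carrier complex_units. y \<otimes>\<^bsub>complex_units\<^esub> x = \<one>\<^bsub>complex_units\<^esub>"
    if "x \<in> carrier complex_units" for x
    using that by (intro bexI[of _ "inverse x"]) (auto simp: complex_units_def)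
qed (auto simp: complex_units_def)

lemma group_hom_jac_dual:
  assumes "phi \<in> jac_dual G"
  shows "group_hom (Jac G) complex_units phi"
  using assms comm_group.axioms(2)[OF comm_group_Jac] group_complex_units
  by (simp add: group_hom_def group_hom_axioms_def jac_dual_def)

lemma jac_dual_mult:
  assumes "phi \<in> jac_dual G" "c \<in> carrier (Jac G)" "d \<in> carrier (Jac G)"
  shows "phi (c \<otimes>\<^bsub>Jac G\<^esub> d) = phi c * phi d"
  using group_hom.hom_mult[OF group_hom_jac_dual] assms by (simp add: complex_units_def)

lemma jac_dual_one: "phi \<in> jac_dual G \<Longrightarrow> phi \<one>\<^bsub>Jac G\<^esub> = 1"
  using group_hom.hom_one[OF group_hom_jac_dual] by (simp add: complex_units_def)

lemma jac_dual_nat_pow: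
  assumes "phi \<in> jac_dual G" "c \<in> carrier (Jac G)"
  shows "phi (c [^]\<^bsub>Jac G\<^esub> (k :: nat)) = phi c ^ k"
proof (induction k)
  case (Suc k)
  interpret comm_group "Jac G" by (rule comm_group_Jac)
  have "c [^]\<^bsub>Jac G\<^esub> k \<in> carrier (Jac G)" using assms(2) by (rule nat_pow_closed)
  then show ?case using Suc assms by (simp add: jac_dual_mult mult.commute)
qed (simp add: jac_dual_one[OF assms(1)])

lemma cis_2pi_eq_iff: "cis (2 * pi * s) = cis (2 * pi * t) \<longleftrightarrow> s - t \<in> \<int>"
proof -
  have "cis (2 * pi * s) = cis (2 * pi * t) \<longleftrightarrow> cis (2 * pi * (s - t)) = 1"
    by (simp add: right_diff_distrib flip: cis_divide)
  also have "\<dots> \<longleftrightarrow> s - t \<in> \<int>"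
  proof
    assume "cis (2 * pi * (s - t)) = 1"
    then have "cos (2 * pi * (s - t)) = 1" by (simp add: complex_eq_iff)
    then obtain k where "2 * pi * (s - t) = of_int k * (2 * pi)" by (auto simp: cos_one_2pi_int)
    then show "s - t \<in> \<int>" by simp
  qed (rule cis_multiple_2pi)
  finally show ?thesis .
qed

lemma jac_dual_of_potentialE:
  assumes "\<And>v. (real_laplacian G *v y) $ v \<in> \<int>"
  obtains phi where "phi \<in> jac_dual G"
    "\<And>D. div_degree D = 0 \<Longrightarrow> phi (jac_class G D) = cis (2 * pi * (y \<bullet> real_divisor D))"
proof -
  define e where "e D = cis (2 * pi * (y \<bullet> real_divisor D))" for D
  interpret group_hom Div0 complex_units e
    using comm_group.axioms(2)[OF comm_group_Div0] group_complex_units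
    by (auto simp: group_hom_def group_hom_axioms_def hom_def Div0_def complex_units_def e_def
        real_divisor_add inner_add_right distrib_left cis_mult)
  have "principal G \<subseteq> kernel Div0 complex_units e"
  proof
    fix A assume A_principal: "A \<in> principal G"
    then obtain f where "A = laplacian G *v f" by (auto simp: principal_def)
    then have "y \<bullet> real_divisor A = (real_laplacian G *v y) \<bullet> real_divisor f"
      by (simp flip: real_laplacian_mult_real_divisor add: inner_real_laplacian)
    also have "\<dots> \<in> \<int>" using assms by (rule inner_real_divisor_in_Ints)
    finally show "A \<in> kernel Div0 complex_units e"
      using div_degree_principal[OF A_principal]
      by (simp add: kernel_def Div0_def complex_units_def e_def cis_multiple_2pi)
  qed
  then obtain phi where phi_hom: "phi \<in> hom (Jac G) complex_units"
    and phi_eq: "\<And>D. D \<in> carrier Div0 \<Longrightarrow> phi (jac_class G D) = e D"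
    using FactGroup_universal_kernel[OF normal_principal] unfolding Jac_def jac_class_def by blast
  show ?thesis
  proof
    have "restrict phi (carrier (Jac G)) \<in> hom (Jac G) complex_units"
      using phi_hom group.is_monoid[OF comm_group.axioms(2)[OF comm_group_Jac[of G]]]
      by (simp add: hom_def monoid.m_closed Pi_iff)
    then show "restrict phi (carrier (Jac G)) \<in> jac_dual G" by (simp add: jac_dual_def)
    show "restrict phi (carrier (Jac G)) (jac_class G D) = cis (2 * pi * (y \<bullet> real_divisor D))"
      if "div_degree D = 0" for D
      using that phi_eq[of D] by (auto simp: Div0_def e_def)
  qed
qed

text \<open>
  If \<open>L g = A - B\<close> and \<open>L y = u - q\<close> over the reals, then self-adjointness gives
  \<open>\<langle>y, A - B\<rangle> = g(u) - g(q)\<close>. So the characters with potentials \<open>y\<close> detect whether \<open>g\<close> is integral,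
  i.e. whether \<open>A - B\<close> is principal.
\<close>

lemma jac_dual_separates:
  assumes conn: "connected_multigraph G" and "c \<in> carrier (Jac G)" "d \<in> carrier (Jac G)"
    and agree: "\<And>phi. phi \<in> jac_dual G \<Longrightarrow> phi c = phi d"
  shows "c = d"
proof -
  obtain A B where cd: "c = jac_class G A" "d = jac_class G B"
    and deg: "div_degree A = 0" "div_degree B = 0"
    using assms by (auto simp: carrier_Jac)
  fix q
  have "(\<Sum>v\<in>UNIV. real_divisor (A - B) $ v) = 0"
    by (simp add: sum_real_divisor deg div_degree_diff del: vector_minus_component)
  then obtain g where Lg: "real_laplacian G *v g = real_divisor (A - B)" and gq: "g $ q = 0"
    using real_laplacian_preimageE[OF conn] by metis
  have "g $ u \<in> \<int>" for u
  proof -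
    define b :: "real ^ 'a" where "b = axis u 1 - axis q 1"
    have "(\<Sum>v\<in>UNIV. b $ v) = 0" by (simp add: b_def sum_subtractf) (simp add: axis_def)
    then obtain y where Ly: "real_laplacian G *v y = b"
      using real_laplacian_preimageE[OF conn] by metis
    have "b $ v \<in> \<int>" for v by (simp add: b_def axis_def)
    then obtain phi where phi: "phi \<in> jac_dual G"
      and phi_eq: "\<And>D. div_degree D = 0 \<Longrightarrow> phi (jac_class G D) = cis (2 * pi * (y \<bullet> real_divisor D))"
      using jac_dual_of_potentialE[of G y] Ly by metis
    have "y \<bullet> real_divisor (A - B) \<in> \<int>"
      using agree[OF phi] cd deg
      by (simp add: phi_eq cis_2pi_eq_iff real_divisor_diff inner_diff_right)
    moreover have "y \<bullet> real_divisor (A - B) = g $ u"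
      using Lg gq inner_real_laplacian[of y G g] Ly by (simp add: b_def inner_diff_left inner_axis')
    ultimately show ?thesis by simp
  qed
  then have "A - B \<in> principal G" using Lg by (intro principalI_real_laplacian)
  then show ?thesis by (simp add: cd jac_class_eq_iff)
qed

subsection \<open>Polynomials with prescribed support\<close>

lemma poly_mapping_sum_singles: "f = (\<Sum>m\<in>keys f. single m (lookup f m))"
  by (rule poly_mapping_eqI) (simp add: lookup_sum lookup_single when_def in_keys_iff)

lemma inj_monomial: "inj (monomial :: 'a \<Rightarrow> 'a \<Rightarrow>\<^sub>0 'b::zero_neq_one)"
  by (rule injI) (metis lookup_single_eq lookup_single_not_eq zero_neq_one)

lemma lookup_times_monomial:
  fixes f :: "'a::cancel_comm_monoid_add \<Rightarrow>\<^sub>0 'b::semiring_1"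
  shows "lookup (f * monomial r) (k + r) = lookup f k"
proof -
  have "f * monomial r = (\<Sum>m\<in>keys f. single (m + r) (lookup f m))"
    by (subst poly_mapping_sum_singles[of f]) (simp add: sum_distrib_right mult_single)
  then show ?thesis by (simp add: lookup_sum lookup_single when_def in_keys_iff)
qed

lemma keys_times_monomial:
  fixes f :: "'a::monoid_add \<Rightarrow>\<^sub>0 'b::semiring_1"
  shows "keys (f * monomial r) \<subseteq> (\<lambda>k. k + r) ` keys f"
  using keys_mult[of f "monomial r"] by auto

definition supported_on :: "'a set \<Rightarrow> ('a \<Rightarrow>\<^sub>0 'b::zero) set" where
  "supported_on A = {f. keys f \<subseteq> A}"

lemma supported_on_iff: "f \<in> supported_on A \<longleftrightarrow> (\<forall>m. m \<notin> A \<longrightarrow> lookup f m = 0)"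
  by (auto simp: supported_on_def in_keys_iff)

lemma lookup_supported_on: "f \<in> supported_on A \<Longrightarrow> m \<notin> A \<Longrightarrow> lookup f m = 0"
  by (simp add: supported_on_iff)

lemma supported_on_UNIV: "supported_on UNIV = UNIV"
  by (simp add: supported_on_def)

lemma single_in_supported_on: "m \<in> A \<Longrightarrow> single m c \<in> supported_on A"
  by (simp add: supported_on_def)

lemma monomial_in_supported_on_iff: "monomial m \<in> supported_on A \<longleftrightarrow> m \<in> A"
  by (simp add: supported_on_def)

lemma sum_in_supported_on:
  "(\<And>i. i \<in> I \<Longrightarrow> f i \<in> supported_on A) \<Longrightarrow> (\<Sum>i\<in>I. f i) \<in> supported_on A"
  by (auto simp: supported_on_iff lookup_sum intro: sum.neutral)

lemma sum_shift_in_supported_on: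
  fixes e :: "'i \<Rightarrow> 'a::comm_monoid_add" and h :: "'i \<Rightarrow> 'a \<Rightarrow>\<^sub>0 'b::semiring_1"
  assumes "\<And>i. i \<in> I \<Longrightarrow> h i \<in> supported_on (A i)"
  shows "(\<Sum>i\<in>I. h i * monomial (e i)) \<in> supported_on (\<Union>i\<in>I. (\<lambda>k. k + e i) ` A i)"
proof (rule sum_in_supported_on)
  fix i assume i_in: "i \<in> I"
  then have "keys (h i * monomial (e i)) \<subseteq> (\<lambda>k. k + e i) ` A i"
    using keys_times_monomial[of "h i" "e i"] assms[OF i_in] by (auto simp: supported_on_def)
  then show "h i * monomial (e i) \<in> supported_on (\<Union>i\<in>I. (\<lambda>k. k + e i) ` A i)"
    using i_in by (auto simp: supported_on_def)
qed

lemma supported_on_UN_shiftE: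
  fixes e :: "'i \<Rightarrow> 'a::comm_monoid_add" and f :: "'a \<Rightarrow>\<^sub>0 'b::semiring_1"
  assumes "finite I" and f_supp: "f \<in> supported_on (\<Union>i\<in>I. (\<lambda>k. k + e i) ` A i)"
  obtains h where "f = (\<Sum>i\<in>I. h i * monomial (e i))" "\<And>i. h i \<in> supported_on (A i)"
proof -
  have "\<forall>m\<in>keys f. \<exists>i k. i \<in> I \<and> k \<in> A i \<and> m = k + e i"
    using f_supp unfolding supported_on_def by blast
  then obtain i k where ik: "\<And>m. m \<in> keys f \<Longrightarrow> i m \<in> I \<and> k m \<in> A (i m) \<and> m = k m + e (i m)"
    by metis
  define h where "h j = (\<Sum>m | m \<in> keys f \<and> i m = j. single (k m) (lookup f m))" for j
  have "(\<Sum>j\<in>I. h j * monomial (e j)) =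
      (\<Sum>j\<in>I. \<Sum>m | m \<in> keys f \<and> i m = j. single m (lookup f m))"
    unfolding h_def sum_distrib_right using ik by (intro sum.cong) (auto simp: mult_single)
  also have "\<dots> = (\<Sum>m\<in>keys f. single m (lookup f m))"
    using ik assms(1) by (intro sum.group) auto
  also have "\<dots> = f" by (rule poly_mapping_sum_singles[symmetric])
  finally have "f = (\<Sum>j\<in>I. h j * monomial (e j))" by (rule sym)
  moreover have "h j \<in> supported_on (A j)" for j
    unfolding h_def by (intro sum_in_supported_on single_in_supported_on) (use ik in auto)
  ultimately show ?thesis by (rule that)
qed

lemma lookup_sum_shift:
  fixes h :: "'i \<Rightarrow> 'a::cancel_comm_monoid_add \<Rightarrow>\<^sub>0 'b::semiring_1"
  assumes "finite I" and inj: "inj_on (\<lambda>(i, k). k + e i) (Sigma I A)"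
    and h_supp: "\<And>i. i \<in> I \<Longrightarrow> h i \<in> supported_on (A i)" and j_in: "j \<in> I" "k \<in> A j"
  shows "lookup (\<Sum>i\<in>I. h i * monomial (e i)) (k + e j) = lookup (h j) k"
proof -
  have "lookup (h i * monomial (e i)) (k + e j) = 0" if i_in: "i \<in> I" "i \<noteq> j" for i
  proof (rule ccontr)
    assume "lookup (h i * monomial (e i)) (k + e j) \<noteq> 0"
    then have "k + e j \<in> keys (h i * monomial (e i))" by (simp add: in_keys_iff)
    then obtain k' where "k' \<in> keys (h i)" and shifts_eq: "k + e j = k' + e i"
      using keys_times_monomial by blast
    then have "k' \<in> A i" using h_supp[OF i_in(1)] by (auto simp: supported_on_def)
    then have "(j, k) = (i, k')" using shifts_eq i_in j_in by (intro inj_onD[OF inj]) simp_all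
    then show False using i_in by simp
  qed
  then have "lookup (\<Sum>i\<in>I. h i * monomial (e i)) (k + e j) =
      (\<Sum>i\<in>I. if i = j then lookup (h j) k else 0)"
    unfolding lookup_sum by (intro sum.cong) (auto simp: lookup_times_monomial)
  then show ?thesis using assms(1) j_in(1) by simp
qed

lemma inj_on_sum_shift:
  fixes e :: "'i \<Rightarrow> 'a::cancel_comm_monoid_add"
  assumes "finite I" and inj: "inj_on (\<lambda>(i, k). k + e i) (Sigma I A)"
  shows "inj_on (\<lambda>h. \<Sum>i\<in>I. h i * monomial (e i))
    (\<Pi>\<^sub>E i\<in>I. supported_on (A i) :: ('a \<Rightarrow>\<^sub>0 'b::semiring_1) set)"
proof (rule inj_onI)
  fix h h' :: "'i \<Rightarrow> 'a \<Rightarrow>\<^sub>0 'b"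
  assume h_in: "h \<in> (\<Pi>\<^sub>E i\<in>I. supported_on (A i))" and h'_in: "h' \<in> (\<Pi>\<^sub>E i\<in>I. supported_on (A i))"
    and sums_eq: "(\<Sum>i\<in>I. h i * monomial (e i)) = (\<Sum>i\<in>I. h' i * monomial (e i))"
  have "lookup (h i) k = lookup (h' i) k" if i_in: "i \<in> I" for i k
  proof (cases "k \<in> A i")
    case True
    have "lookup (h i) k = lookup (\<Sum>i\<in>I. h i * monomial (e i)) (k + e i)"
      using h_in by (intro lookup_sum_shift[OF assms _ i_in True, symmetric]) auto
    also have "\<dots> = lookup (h' i) k"
      unfolding sums_eq using h'_in by (intro lookup_sum_shift[OF assms _ i_in True]) auto
    finally show ?thesis .
  next
    case False
    then show ?thesis
      using PiE_mem[OF h_in i_in] PiE_mem[OF h'_in i_in] by (simp add: lookup_supported_on)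
  qed
  then show "h = h'" by (intro PiE_ext[OF h_in h'_in] poly_mapping_eqI)
qed

lemma bij_betw_sum_shift:
  fixes e :: "'i \<Rightarrow> 'a::cancel_comm_monoid_add"
  assumes "finite I" and bij: "bij_betw (\<lambda>(i, k). k + e i) (Sigma I A) Z"
  shows "bij_betw (\<lambda>h. \<Sum>i\<in>I. h i * monomial (e i))
    (\<Pi>\<^sub>E i\<in>I. supported_on (A i)) (supported_on Z :: ('a \<Rightarrow>\<^sub>0 'b::semiring_1) set)"
proof (rule bij_betw_imageI)
  show "inj_on (\<lambda>h. \<Sum>i\<in>I. h i * monomial (e i))
      (\<Pi>\<^sub>E i\<in>I. supported_on (A i) :: ('a \<Rightarrow>\<^sub>0 'b) set)"
    using assms(1) bij_betw_imp_inj_on[OF bij] by (rule inj_on_sum_shift)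
  have "(\<Union>i\<in>I. (\<lambda>k. k + e i) ` A i) = (\<lambda>(i, k). k + e i) ` Sigma I A" by auto
  also have "\<dots> = Z" using bij by (rule bij_betw_imp_surj_on)
  finally have UN_eq: "(\<Union>i\<in>I. (\<lambda>k. k + e i) ` A i) = Z" .
  show "(\<lambda>h. \<Sum>i\<in>I. h i * monomial (e i)) ` (\<Pi>\<^sub>E i\<in>I. supported_on (A i)) =
      (supported_on Z :: ('a \<Rightarrow>\<^sub>0 'b) set)"
    unfolding UN_eq[symmetric]
  proof (intro equalityI subsetI)
    fix f :: "'a \<Rightarrow>\<^sub>0 'b" assume "f \<in> supported_on (\<Union>i\<in>I. (\<lambda>k. k + e i) ` A i)"
    then obtain h where "f = (\<Sum>i\<in>I. h i * monomial (e i))" "\<And>i. h i \<in> supported_on (A i)"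
      using supported_on_UN_shiftE[OF assms(1)] by blast
    then show "f \<in> (\<lambda>h. \<Sum>i\<in>I. h i * monomial (e i)) ` (\<Pi>\<^sub>E i\<in>I. supported_on (A i))"
      by (intro image_eqI[of _ _ "restrict h I"]) auto
  qed (auto intro!: sum_shift_in_supported_on)
qed

lemma supported_on_direct_sum:
  fixes f :: "'a::cancel_comm_monoid_add \<Rightarrow>\<^sub>0 'b::semiring_1"
  assumes "finite I" "range c \<subseteq> I"
  shows "\<exists>!h. h \<in> (\<Pi>\<^sub>E i\<in>I. supported_on {m. c m = i}) \<and> f = (\<Sum>i\<in>I. h i)"
proof -
  have "bij_betw (\<lambda>(i, k). k + 0) (SIGMA i:I. {m. c m = i}) UNIV"
    using assms(2) by (intro bij_betwI[of _ _ _ "\<lambda>m. (c m, m)"]) auto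
  from bij_betw_sum_shift[OF assms(1) this]
  have bij: "bij_betw (\<lambda>h. \<Sum>i\<in>I. h i) (\<Pi>\<^sub>E i\<in>I. supported_on {m. c m = i})
      (UNIV :: ('a \<Rightarrow>\<^sub>0 'b) set)"
    by (simp add: supported_on_UNIV)
  have "f \<in> (\<lambda>h. \<Sum>i\<in>I. h i) ` (\<Pi>\<^sub>E i\<in>I. supported_on {m. c m = i})"
    unfolding bij_betw_imp_surj_on[OF bij] by simp
  then show ?thesis
    using bij_betw_imp_inj_on[OF bij] by (auto dest: inj_onD)
qed

lemma fin_free_module_supported_on:
  fixes R N Z :: "('v::finite \<Rightarrow>\<^sub>0 nat) set"
  assumes "finite R" "R \<subseteq> Z" and bij: "bij_betw (\<lambda>(r, k). k + r) (R \<times> N) Z"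
  shows "fin_free_module (supported_on N) (supported_on Z)"
proof -
  define e where "e = (inv_into UNIV monomial :: 'v cpoly \<Rightarrow> 'v \<Rightarrow>\<^sub>0 nat)"
  have e_monomial: "e (monomial m) = m" for m by (simp add: e_def inv_f_f[OF inj_monomial])
  have "bij_betw e (monomial ` R) R"
    by (rule bij_betwI[of _ _ _ monomial]) (auto simp: e_monomial)
  then have "bij_betw ((\<lambda>(r, k). k + r) \<circ> map_prod e id) (monomial ` R \<times> N) Z"
    by (intro bij_betw_trans[OF bij_betw_map_prod bij] bij_betw_id)
  then have "bij_betw (\<lambda>(b, k). k + e b) (monomial ` R \<times> N) Z"
    by (simp add: comp_def case_prod_unfold map_prod_def)
  from bij_betw_sum_shift[OF finite_imageI[OF assms(1)] this]
  have "bij_betw (\<lambda>a :: 'v cpoly \<Rightarrow> 'v cpoly. \<Sum>b\<in>monomial ` R. a b * monomial (e b))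
      (monomial ` R \<rightarrow>\<^sub>E supported_on N) (supported_on Z)" .
  moreover have "(\<Sum>b\<in>monomial ` R. a b * monomial (e b)) = (\<Sum>b\<in>monomial ` R. a b * b)"
    for a :: "'v cpoly \<Rightarrow> 'v cpoly"
    by (rule sum.cong) (auto simp: e_monomial)
  ultimately show ?thesis
    unfolding fin_free_module_def using assms(1,2)
    by (intro exI[of _ "monomial ` R"]) (auto simp: monomial_in_supported_on_iff)
qed

subsection \<open>Bases of monomials\<close>

lemma lookup_scale_poly [simp]: "lookup (scale_poly c f) m = c * lookup f m"
  by (simp add: scale_poly_def const_poly_def flip: mult_map_scale_conv_mult)
    (simp add: Poly_Mapping.map.rep_eq when_def)

lemma scale_poly_single: "scale_poly c (single m d) = single m (c * d)"
  by (simp add: scale_poly_def const_poly_def mult_single)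

lemma lookup_sum_scale_monomials:
  assumes "finite Q" "Q \<subseteq> range monomial"
  shows "lookup (\<Sum>b\<in>Q. scale_poly (a b) b) m = (if monomial m \<in> Q then a (monomial m) else 0)"
proof -
  have "lookup (\<Sum>b\<in>Q. scale_poly (a b) b) m = (\<Sum>b\<in>Q. if b = monomial m then a b else 0)"
    unfolding lookup_sum
  proof (rule sum.cong[OF refl])
    fix b assume "b \<in> Q"
    then obtain r where "b = monomial r" using assms(2) by auto
    then show "lookup (scale_poly (a b) b) m = (if b = monomial m then a b else 0)"
      using injD[OF inj_monomial, of r m] by (auto simp: lookup_single when_def)
  qed
  then show ?thesis using assms(1) by simp
qed

lemma subspace_supported_on: "cpoly.subspace (supported_on A)"
  by (rule cpoly.subspaceI) (auto simp: supported_on_iff lookup_add)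

lemma span_monomials:
  fixes A :: "('v \<Rightarrow>\<^sub>0 nat) set"
  shows "cpoly.span (monomial ` A) = supported_on A"
proof
  show "cpoly.span (monomial ` A) \<subseteq> supported_on A"
    by (rule cpoly.span_minimal) (auto simp: subspace_supported_on single_in_supported_on)
  show "supported_on A \<subseteq> cpoly.span (monomial ` A)"
  proof
    fix f :: "'v cpoly" assume f_supp: "f \<in> supported_on A"
    have "(\<Sum>m\<in>keys f. scale_poly (lookup f m) (monomial m)) \<in> cpoly.span (monomial ` A)"
      by (intro cpoly.span_sum cpoly.span_scale cpoly.span_base)
        (use f_supp in \<open>auto simp: supported_on_def\<close>)
    then show "f \<in> cpoly.span (monomial ` A)"
      using poly_mapping_sum_singles[of f] by (simp add: scale_poly_single)
  qed
qed

lemma independent_monomials: "cpoly.independent (monomial ` A)"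
proof
  assume "cpoly.dependent (monomial ` A)"
  then obtain t a b where t_sub: "finite t" "t \<subseteq> monomial ` A"
    and sum_0: "(\<Sum>v\<in>t. scale_poly (a v) v) = 0" and b_in: "b \<in> t" "a b \<noteq> 0"
    unfolding cpoly.dependent_explicit by blast
  obtain m where b_eq: "b = monomial m" using t_sub b_in by auto
  have "t \<subseteq> range monomial" using t_sub by auto
  from lookup_sum_scale_monomials[OF t_sub(1) this, of a m] show False
    using sum_0 b_in b_eq by simp
qed

lemma diff_sum_scale_monomials_in_supported_on_iff:
  assumes "finite Q" "Q \<subseteq> range monomial"
  shows "f - (\<Sum>b\<in>Q. scale_poly (a b) b) \<in> supported_on T \<longleftrightarrow>
    (\<forall>m. m \<notin> T \<longrightarrow> lookup f m = (if monomial m \<in> Q then a (monomial m) else 0))"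
  unfolding supported_on_iff lookup_minus lookup_sum_scale_monomials[OF assms] by auto

lemma basis_modulo_supported_onI:
  assumes "finite (C - T)"
  shows "basis_modulo (monomial ` (C - T)) (supported_on C) (supported_on T)"
  unfolding basis_modulo_def
proof (intro conjI ballI)
  let ?Q = "monomial ` (C - T) :: 'a cpoly set"
  show fin: "finite ?Q" using assms by simp
  show "?Q \<subseteq> supported_on C" by (auto simp: monomial_in_supported_on_iff)
  have in_Q: "monomial m \<in> ?Q \<longleftrightarrow> m \<in> C - T" for m by (rule inj_image_mem_iff[OF inj_monomial])
  fix f :: "'a cpoly" assume f_supp: "f \<in> supported_on C"
  have mod_iff: "f - (\<Sum>b\<in>?Q. scale_poly (a b) b) \<in> supported_on T \<longleftrightarrow>
      (\<forall>m\<in>C - T. a (monomial m) = lookup f m)" for a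
    using f_supp by (subst diff_sum_scale_monomials_in_supported_on_iff[OF fin])
      (auto simp: in_Q supported_on_iff)
  show "\<exists>!a. a \<in> (?Q \<rightarrow>\<^sub>E UNIV) \<and> f - (\<Sum>b\<in>?Q. scale_poly (a b) b) \<in> supported_on T"
  proof (rule ex1I[of _ "\<lambda>b\<in>?Q. lookup f (inv_into UNIV monomial b)"])
    fix a assume "a \<in> (?Q \<rightarrow>\<^sub>E UNIV) \<and> f - (\<Sum>b\<in>?Q. scale_poly (a b) b) \<in> supported_on T"
    then show "a = (\<lambda>b\<in>?Q. lookup f (inv_into UNIV monomial b))"
      by (intro extensionalityI[of _ ?Q]) (auto simp: mod_iff inv_f_f[OF inj_monomial] PiE_def)
  qed (simp add: mod_iff inv_f_f[OF inj_monomial])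
qed

lemma basis_modulo_supported_onD:
  fixes Q :: "'v cpoly set"
  assumes basis: "basis_modulo Q (supported_on C) (supported_on T)"
    and Q_monomials: "Q \<subseteq> range monomial"
  shows "Q = monomial ` (C - T)"
proof -
  have fin: "finite Q" and QC: "Q \<subseteq> supported_on C"
    and ex1: "\<And>f. f \<in> supported_on C \<Longrightarrow>
      \<exists>!a. a \<in> (Q \<rightarrow>\<^sub>E UNIV) \<and> f - (\<Sum>b\<in>Q. scale_poly (a b) b) \<in> supported_on T"
    using basis by (auto simp: basis_modulo_def)
  note mod_iff = diff_sum_scale_monomials_in_supported_on_iff[OF fin Q_monomials]
  have "m \<in> C - T" if m_in: "monomial m \<in> Q" for m
  proof -
    have "m \<notin> T"
    proof
      assume "m \<in> T"
      define a where "a = (\<lambda>b\<in>Q. 0 :: complex)"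
      define a' where "a' = (\<lambda>b\<in>Q. if b = monomial m then 1 else 0 :: complex)"
      have "a \<in> (Q \<rightarrow>\<^sub>E UNIV)" "0 - (\<Sum>b\<in>Q. scale_poly (a b) b) \<in> supported_on T"
        unfolding mod_iff by (simp_all add: a_def)
      moreover have "a' \<in> (Q \<rightarrow>\<^sub>E UNIV)" "0 - (\<Sum>b\<in>Q. scale_poly (a' b) b) \<in> supported_on T"
        unfolding mod_iff using \<open>m \<in> T\<close> by (auto simp: a'_def inj_eq[OF inj_monomial])
      moreover have "(0 :: 'v cpoly) \<in> supported_on C" by (simp add: supported_on_iff)
      ultimately have "a = a'" using ex1 by blast
      then have "a (monomial m) = a' (monomial m)" by (rule fun_cong)
      then show False using m_in by (simp add: a_def a'_def)
    qed
    then show ?thesis using m_in QC by (auto simp: monomial_in_supported_on_iff)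
  qed
  moreover have "monomial m \<in> Q" if m_in: "m \<in> C - T" for m
  proof -
    obtain a where "monomial m - (\<Sum>b\<in>Q. scale_poly (a b) b) \<in> supported_on T"
      using ex1[of "monomial m"] m_in by (auto simp: monomial_in_supported_on_iff)
    then show ?thesis using m_in unfolding mod_iff by (metis DiffD2 lookup_single_eq zero_neq_one)
  qed
  ultimately show ?thesis using Q_monomials by blast
qed

lemma basis_modulo_supported_on_iff:
  assumes "finite (C - T)" "Q \<subseteq> range monomial"
  shows "basis_modulo Q (supported_on C) (supported_on T) \<longleftrightarrow> Q = monomial ` (C - T)"
  using basis_modulo_supported_onI[OF assms(1)] basis_modulo_supported_onD[OF _ assms(2)] by blast

subsection \<open>Substitution of monomials\<close>

lemma power_single:
  fixes c :: "'b::comm_semiring_1"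
  shows "single m c ^ k = single (\<Sum>i<k. m) (c ^ k)"
  by (induction k) (simp_all add: mult_single add.commute flip: single_one)

lemma prod_single:
  fixes c :: "'i \<Rightarrow> 'b::comm_semiring_1"
  assumes "finite I"
  shows "(\<Prod>i\<in>I. single (g i) (c i)) = single (\<Sum>i\<in>I. g i) (\<Prod>i\<in>I. c i)"
  using assms by (induction I) (simp_all add: mult_single)

definition exp_comb :: "('v::finite \<Rightarrow> 'w \<Rightarrow>\<^sub>0 nat) \<Rightarrow> ('v \<Rightarrow>\<^sub>0 nat) \<Rightarrow> 'w \<Rightarrow>\<^sub>0 nat" where
  "exp_comb g m = (\<Sum>v\<in>UNIV. \<Sum>i<lookup m v. g v)"

lemma lookup_exp_comb: "lookup (exp_comb g m) u = (\<Sum>v\<in>UNIV. lookup m v * lookup (g v) u)"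
  by (simp add: exp_comb_def lookup_sum)

lemma lookup_exp_comb_singles: "lookup (exp_comb (\<lambda>v. single v (l v)) m) v = lookup m v * l v"
  by (simp add: lookup_exp_comb lookup_single when_def if_distrib[of "\<lambda>x. _ * x"] cong: if_cong)

lemma exp_comb_variables: "exp_comb (\<lambda>v. single v (Suc 0)) m = m"
  by (rule poly_mapping_eqI) (simp add: lookup_exp_comb_singles)

lemma prod_single_power:
  fixes c :: "'v::finite \<Rightarrow> 'b::comm_semiring_1"
  shows "(\<Prod>v\<in>UNIV. single (g v) (c v) ^ lookup m v) =
    single (exp_comb g m) (\<Prod>v\<in>UNIV. c v ^ lookup m v)"
  by (simp add: power_single prod_single exp_comb_def)

lemma subst_poly_single:
  "subst_poly (\<lambda>v. single (g v) (c v)) f =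
    (\<Sum>m\<in>keys f. single (exp_comb g m) (lookup f m * (\<Prod>v\<in>UNIV. c v ^ lookup m v)))"
  by (simp add: subst_poly_def prod_single_power scale_poly_single)

lemma subst_poly_superset:
  assumes "finite A" "keys f \<subseteq> A"
  shows "subst_poly p f = (\<Sum>m\<in>A. scale_poly (lookup f m) (\<Prod>v\<in>UNIV. p v ^ lookup m v))"
  unfolding subst_poly_def using assms by (intro sum.mono_neutral_left) (auto simp: in_keys_iff)

lemma subspace_gen_subalgebra: "cpoly.subspace (gen_subalgebra p)"
proof -
  have add: "subst_poly p (f + h) = subst_poly p f + subst_poly p h" for f h
    using keys_add[of f h]
    by (simp add: subst_poly_superset[of "keys f \<union> keys h"] lookup_add cpoly.scale_left_distrib
        sum.distrib)
  have scale: "subst_poly p (scale_poly c f) = scale_poly c (subst_poly p f)" for c f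
  proof -
    have "keys (scale_poly c f) \<subseteq> keys f" by (auto simp: in_keys_iff)
    then show ?thesis
      by (simp add: subst_poly_superset[of "keys f"] cpoly.scale_sum_right)
  qed
  have "0 = subst_poly p 0" by (simp add: subst_poly_def)
  then show ?thesis
    unfolding gen_subalgebra_def
    by (intro cpoly.subspaceI) (auto simp flip: add scale)
qed

lemma gen_subalgebra_monomials:
  "gen_subalgebra (\<lambda>v. monomial (g v)) = supported_on (range (exp_comb g))"
proof
  show "gen_subalgebra (\<lambda>v. monomial (g v)) \<subseteq> supported_on (range (exp_comb g))"
    by (auto simp: gen_subalgebra_def subst_poly_single
        intro!: sum_in_supported_on single_in_supported_on)
  have "monomial (exp_comb g m) = subst_poly (\<lambda>v. monomial (g v)) (monomial m)" for m
    by (simp add: subst_poly_single)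
  then have "monomial ` range (exp_comb g) \<subseteq> gen_subalgebra (\<lambda>v. monomial (g v))"
    by (auto simp: gen_subalgebra_def)
  then show "supported_on (range (exp_comb g)) \<subseteq> gen_subalgebra (\<lambda>v. monomial (g v))"
    unfolding span_monomials[symmetric] by (intro cpoly.span_minimal subspace_gen_subalgebra)
qed

lemma alg_independent_monomials:
  assumes "inj (exp_comb g)"
  shows "alg_independent (\<lambda>v. monomial (g v))"
  unfolding alg_independent_def
proof (intro allI impI poly_mapping_eqI)
  fix f m assume "subst_poly (\<lambda>v. monomial (g v)) f = 0"
  then have "lookup (subst_poly (\<lambda>v. monomial (g v)) f) (exp_comb g m) = 0" by simp
  then show "lookup f m = lookup 0 m"
    by (simp add: subst_poly_single lookup_sum lookup_single when_def in_keys_iff inj_eq[OF assms]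
        split: if_splits)
qed

lemma lookup_compose_matrix_diagonal:
  assumes "\<And>v w. A $ v $ w = (if v = w then d v else 0)"
  shows "lookup (compose_matrix f A) m = lookup f m * (\<Prod>v\<in>UNIV. d v ^ lookup m v)"
proof -
  have "(\<Sum>w\<in>UNIV. scale_poly (A $ v $ w) (var_poly w)) = single (single v (Suc 0)) (d v)" for v
  proof -
    have "(\<Sum>w\<in>UNIV. scale_poly (A $ v $ w) (var_poly w)) =
        (\<Sum>w\<in>UNIV. if w = v then scale_poly (d v) (var_poly v) else 0)"
      by (rule sum.cong) (auto simp: assms)
    then show ?thesis by (simp add: var_poly_def scale_poly_single)
  qed
  then have "compose_matrix f A =
      (\<Sum>m\<in>keys f. single m (lookup f m * (\<Prod>v\<in>UNIV. d v ^ lookup m v)))"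
    by (simp add: compose_matrix_def subst_poly_single exp_comb_variables)
  then show ?thesis by (simp add: lookup_sum lookup_single when_def in_keys_iff)
qed

text \<open>
  A product of two monomials is a pure power of \<open>x u\<close> only if both factors are. So if \<open>N\<close> contains
  no pure power of \<open>x u\<close> but the constant, then a finitely generated module over the polynomials
  supported on \<open>N\<close> contains only the finitely many pure powers that occur in its generators.
\<close>

lemma pure_power_in_generated_exps:
  fixes B :: "'v cpoly set"
  assumes "finite B" "infinite J"
    and gen: "\<And>j. j \<in> J \<Longrightarrow>
      \<exists>a. (\<forall>b\<in>B. a b \<in> supported_on N) \<and> monomial (single u j) = (\<Sum>b\<in>B. a b * b)"
  shows "\<exists>i>0. single u i \<in> N"
proof (rule ccontr)
  assume "\<not> (\<exists>i>0. single u i \<in> N)"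
  then have no_power: "\<And>i. single u i \<in> N \<Longrightarrow> i = 0" by auto
  have "J \<subseteq> (\<lambda>m. lookup m u) ` (\<Union>b\<in>B. keys b)"
  proof
    fix j assume "j \<in> J"
    then obtain a where a_supp: "\<And>b. b \<in> B \<Longrightarrow> a b \<in> supported_on N"
      and sum_eq: "monomial (single u j) = (\<Sum>b\<in>B. a b * b)"
      using gen by blast
    have "single u j \<in> keys (\<Sum>b\<in>B. a b * b)" by (simp flip: sum_eq)
    then obtain b where b_in: "b \<in> B" "single u j \<in> keys (a b * b)"
      using keys_sum[of "\<lambda>b. a b * b" B] by blast
    then obtain k k' where k_in: "k \<in> keys (a b)" "k' \<in> keys b" and single_eq: "single u j = k + k'"
      using keys_mult[of "a b" b] by blast
    have lookup_at: "lookup k w + lookup k' w = (if w = u then j else 0)" for w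
      unfolding lookup_add[symmetric] single_eq[symmetric] by (simp add: lookup_single when_def)
    have "k = single u (lookup k u)"
    proof (rule poly_mapping_eqI)
      show "lookup k w = lookup (single u (lookup k u)) w" for w
        using lookup_at[of w] by (simp add: lookup_single when_def split: if_splits)
    qed
    moreover have "k \<in> N" using a_supp[OF b_in(1)] k_in(1) by (auto simp: supported_on_def)
    ultimately have "single u (lookup k u) \<in> N" by (rule subst)
    then have "lookup k u = 0" by (rule no_power)
    then have "j = lookup k' u" using lookup_at[of u] by simp
    then show "j \<in> (\<lambda>m. lookup m u) ` (\<Union>b\<in>B. keys b)" using b_in(1) k_in(2) by blast
  qed
  then have "finite J" by (rule finite_subset) (simp add: assms(1))
  then show False using assms(2) by simp
qed

lemma pure_power_exp_combE:
  assumes "single u i = exp_comb g m" "0 < i"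
  obtains v j where "0 < j" "g v = single u j"
proof -
  have sum_at: "(\<Sum>v\<in>UNIV. lookup m v * lookup (g v) w) = (if w = u then i else 0)" for w
    by (simp add: lookup_single when_def flip: lookup_exp_comb assms(1))
  have "(\<Sum>v\<in>UNIV. lookup m v * lookup (g v) u) \<noteq> 0" using sum_at[of u] assms(2) by simp
  then obtain v where nonzero: "lookup m v * lookup (g v) u \<noteq> 0"
    by (rule sum.not_neutral_contains_not_neutral)
  have "g v = single u (lookup (g v) u)"
  proof (rule poly_mapping_eqI)
    show "lookup (g v) w = lookup (single u (lookup (g v) u)) w" for w
      using sum_at[of w] nonzero
      by (cases "w = u") (auto simp: lookup_single when_def dest: spec[of _ v])
  qed
  with nonzero show ?thesis by (intro that[of "lookup (g v) u" v]) auto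
qed

subsection \<open>Monomials of effective divisors\<close>

lemma div_monomial_exp_divisor: "div_monomial (exp_divisor m) = monomial m"
  by (simp add: div_monomial_def var_poly_def prod_single_power exp_divisor_def exp_comb_variables)

lemma div_monomial_image_exp_divisor: "div_monomial ` exp_divisor ` A = monomial ` A"
  by (simp add: image_image div_monomial_exp_divisor)

lemma monomials_eq_range: "monomials = range monomial"
  by (simp add: monomials_def Collect_effective div_monomial_image_exp_divisor)

lemma inj_on_div_monomial: "inj_on div_monomial {E. effective E}"
  unfolding Collect_effective
  by (rule inj_onI) (auto simp: div_monomial_exp_divisor dest: injD[OF inj_monomial])

lemma homogeneous_monomial: "homogeneous_poly (monomial m)"
  by (simp add: homogeneous_poly_def)

definition class_exps :: "'v::finite multigraph \<Rightarrow> 'v \<Rightarrow> 'v divisor set \<Rightarrow> ('v \<Rightarrow>\<^sub>0 nat) set" where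
  "class_exps G q c = {m. exp_class G q m = c}"

lemma effective_class_eq_image:
  assumes "div_degree D = 0"
  shows "effective_class G q D = exp_divisor ` class_exps G q (jac_class G D)"
proof -
  have "effective_class G q D =
      {E \<in> range exp_divisor. jac_class G (E - div_degree E *s vertex_div q) = jac_class G D}"
    unfolding Collect_effective[symmetric] using mem_effective_class_iff[OF assms] by blast
  then show ?thesis by (auto simp: class_exps_def exp_class_def)
qed

lemma add_in_class_exps_iff:
  assumes "k \<in> class_exps G q \<one>\<^bsub>Jac G\<^esub>"
  shows "k + m \<in> class_exps G q c \<longleftrightarrow> m \<in> class_exps G q c"
proof -
  interpret comm_group "Jac G" by (rule comm_group_Jac)
  show ?thesis using assms by (simp add: class_exps_def exp_class_add)
qed

lemma sum_in_class_exps_one: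
  assumes "\<And>i. i \<in> I \<Longrightarrow> f i \<in> class_exps G q \<one>\<^bsub>Jac G\<^esub>"
  shows "(\<Sum>i\<in>I. f i) \<in> class_exps G q \<one>\<^bsub>Jac G\<^esub>"
  using assms
  by (induction I rule: infinite_finite_induct)
    (simp_all add: add_in_class_exps_iff, simp_all add: class_exps_def exp_class_zero)

subsection \<open>Relative invariants of the Jacobian\<close>

lemma jac_dual_exp_class:
  assumes phi: "phi \<in> jac_dual G"
  shows "phi (exp_class G q m) =
    (\<Prod>v\<in>UNIV. phi (vertex_class G q v) ^ lookup m v)"
proof -
  have single: "phi (exp_class G q (single v k)) =
      phi (vertex_class G q v) ^ k" for v k
    unfolding exp_class_single by (rule jac_dual_nat_pow[OF phi vertex_class_in_carrier])
  have "phi (exp_class G q (\<Sum>v\<in>S. single v (lookup m v))) =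
      (\<Prod>v\<in>S. phi (vertex_class G q v) ^ lookup m v)" for S
    using finite[of S]
  proof induction
    case empty
    then show ?case by (simp add: exp_class_zero jac_dual_one[OF phi])
  next
    case (insert v S)
    then show ?case by (simp add: exp_class_add jac_dual_mult[OF phi] single)
  qed
  moreover have "m = (\<Sum>v\<in>UNIV. single v (lookup m v))"
    by (rule poly_mapping_eqI) (simp add: lookup_sum lookup_single when_def)
  ultimately show ?thesis by metis
qed

lemma lookup_compose_rho:
  assumes "phi \<in> jac_dual G"
  shows "lookup (compose_matrix f (rho G q phi)) m = lookup f m * phi (exp_class G q m)"
proof -
  have "lookup (compose_matrix f (rho G q phi)) m = lookup f m *
     (\<Prod>v\<in>UNIV. phi (vertex_class G q v) ^ lookup m v)"
    by (rule lookup_compose_matrix_diagonal)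
      (auto simp: rho_def jac_class_zero jac_dual_one[OF assms])
  then show ?thesis by (simp add: jac_dual_exp_class[OF assms])
qed

lemma rel_invariants_eq_supported_on:
  assumes conn: "connected_multigraph G" and c_in: "c \<in> carrier (Jac G)"
  shows "rel_invariants (Jac_Gamma G q) (jac_char G q c) = supported_on (class_exps G q c)"
proof -
  have "f \<in> rel_invariants (Jac_Gamma G q) (jac_char G q c) \<longleftrightarrow>
      f \<in> supported_on (class_exps G q c)" for f
  proof -
    have "f \<in> rel_invariants (Jac_Gamma G q) (jac_char G q c) \<longleftrightarrow>
        (\<forall>phi\<in>jac_dual G. \<forall>m. lookup f m * phi (exp_class G q m) = phi c * lookup f m)"
      by (auto simp: rel_invariants_def Jac_Gamma_def jac_char_rho poly_mapping_eq_iff fun_eq_iff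
          lookup_compose_rho)
    also have "\<dots> \<longleftrightarrow> (\<forall>m\<in>keys f. \<forall>phi\<in>jac_dual G. phi (exp_class G q m) = phi c)"
      by (auto simp: in_keys_iff)
    also have "\<dots> \<longleftrightarrow> (\<forall>m\<in>keys f. exp_class G q m = c)"
      using jac_dual_separates[OF conn exp_class_in_carrier c_in] by metis
    finally show ?thesis by (auto simp: supported_on_def class_exps_def)
  qed
  then show ?thesis by blast
qed

lemma invariants_eq_supported_on:
  assumes "connected_multigraph G"
  shows "invariants (Jac_Gamma G q) = supported_on (class_exps G q \<one>\<^bsub>Jac G\<^esub>)"
proof -
  interpret comm_group "Jac G" by (rule comm_group_Jac)
  from rel_invariants_eq_supported_on[OF assms one_closed]
  have "supported_on (class_exps G q \<one>\<^bsub>Jac G\<^esub>) =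
      rel_invariants (Jac_Gamma G q) (jac_char G q \<one>\<^bsub>Jac G\<^esub>)" by (rule sym)
  also have "\<dots> = invariants (Jac_Gamma G q)"
    by (auto simp: rel_invariants_def Jac_Gamma_def jac_char_rho jac_dual_one)
  finally show ?thesis by (rule sym)
qed

lemma independent_monomials_effective_class:
  assumes "div_degree D = 0"
  shows "cpoly.independent (div_monomial ` effective_class G q D)"
  by (simp add: effective_class_eq_image[OF assms] div_monomial_image_exp_divisor
      independent_monomials)

lemma span_monomials_effective_class:
  assumes "connected_multigraph G" "div_degree D = 0"
  shows "cpoly.span (div_monomial ` effective_class G q D) =
    rel_invariants (Jac_Gamma G q) (jac_char G q (jac_class G D))"
  by (simp add: effective_class_eq_image[OF assms(2)] div_monomial_image_exp_divisor span_monomials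
      rel_invariants_eq_supported_on[OF assms(1) jac_class_in_carrier[OF assms(2)]])

lemma direct_sum_rel_invariants:
  fixes f :: "'v::finite cpoly"
  assumes "connected_multigraph G"
  shows "\<exists>!h. h \<in> (\<Pi>\<^sub>E c\<in>carrier (Jac G). rel_invariants (Jac_Gamma G q) (jac_char G q c)) \<and>
    f = (\<Sum>c\<in>carrier (Jac G). h c)"
proof -
  have PiE_eq: "(\<Pi>\<^sub>E c\<in>carrier (Jac G). rel_invariants (Jac_Gamma G q) (jac_char G q c)) =
      (\<Pi>\<^sub>E c\<in>carrier (Jac G). supported_on {m. exp_class G q m = c})"
    by (intro PiE_cong) (simp add: rel_invariants_eq_supported_on[OF assms] class_exps_def)
  have "range (exp_class G q) \<subseteq> carrier (Jac G)" by auto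
  from supported_on_direct_sum[OF finite_carrier_Jac[OF assms] this] show ?thesis unfolding PiE_eq .
qed

subsection \<open>Pure powers as primary invariants\<close>

abbreviation pure_powers :: "('v::finite \<Rightarrow> nat) \<Rightarrow> 'v \<Rightarrow> 'v cpoly" where
  "pure_powers l v \<equiv> monomial (single v (l v))"

definition multiple_exps :: "('v::finite \<Rightarrow> nat) \<Rightarrow> ('v \<Rightarrow>\<^sub>0 nat) set" where
  "multiple_exps l = {m. \<forall>v. l v dvd lookup m v}"

lemma range_exp_comb_singles: "range (exp_comb (\<lambda>v. single v (l v))) = multiple_exps l"
proof (intro equalityI subsetI)
  fix m assume m_in: "m \<in> multiple_exps l"
  have "m = exp_comb (\<lambda>v. single v (l v)) (Abs_poly_mapping (\<lambda>v. lookup m v div l v))"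
    by (rule poly_mapping_eqI) (use m_in in \<open>simp add: lookup_exp_comb_singles multiple_exps_def\<close>)
  then show "m \<in> range (exp_comb (\<lambda>v. single v (l v)))" by blast
qed (auto simp: multiple_exps_def lookup_exp_comb_singles)

lemma inj_exp_comb_singles:
  assumes "\<And>v. 0 < l v"
  shows "inj (exp_comb (\<lambda>v. single v (l v)))"
proof (rule injI, rule poly_mapping_eqI)
  fix m k v assume comb_eq: "exp_comb (\<lambda>v. single v (l v)) m = exp_comb (\<lambda>v. single v (l v)) k"
  have "lookup m v * l v = lookup k v * l v" by (simp flip: lookup_exp_comb_singles add: comb_eq)
  then show "lookup m v = lookup k v" using assms[of v] by simp
qed

definition exp_mod :: "('v::finite \<Rightarrow> nat) \<Rightarrow> ('v \<Rightarrow>\<^sub>0 nat) \<Rightarrow> 'v \<Rightarrow>\<^sub>0 nat" where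
  "exp_mod l m = Abs_poly_mapping (\<lambda>v. lookup m v mod l v)"

lemma lookup_exp_mod: "lookup (exp_mod l m) v = lookup m v mod l v"
  by (simp add: exp_mod_def)

lemma exp_mod_in_bounded_exps: "(\<And>v. 0 < l v) \<Longrightarrow> exp_mod l m \<in> bounded_exps l"
  by (simp add: bounded_exps_def lookup_exp_mod)

lemma minus_exp_mod_in_multiple_exps: "m - exp_mod l m \<in> multiple_exps l"
  by (simp add: multiple_exps_def lookup_minus lookup_exp_mod dvd_minus_mod)

lemma minus_exp_mod_add: "m - exp_mod l m + exp_mod l m = m"
  by (rule poly_mapping_eqI) (simp add: lookup_add lookup_minus lookup_exp_mod)

lemma exp_mod_add_multiple:
  assumes "r \<in> bounded_exps l" "k \<in> multiple_exps l"
  shows "exp_mod l (k + r) = r"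
proof (rule poly_mapping_eqI)
  fix v
  have "lookup r v < l v" "l v dvd lookup k v"
    using assms by (auto simp: bounded_exps_def multiple_exps_def)
  then show "lookup (exp_mod l (k + r)) v = lookup r v"
    by (auto simp: lookup_exp_mod lookup_add elim: dvdE)
qed

lemma bij_betw_exp_division:
  fixes l :: "'v::finite \<Rightarrow> nat"
  assumes l_pos: "\<And>v. 0 < l v" and Z_closed: "\<And>m k. k \<in> multiple_exps l \<Longrightarrow> k + m \<in> Z \<longleftrightarrow> m \<in> Z"
  shows "bij_betw (\<lambda>(r, k). k + r) ((Z \<inter> bounded_exps l) \<times> multiple_exps l) Z"
proof (rule bij_betwI[of _ _ _ "\<lambda>m. (exp_mod l m, m - exp_mod l m)"])
  show "(\<lambda>(r, k). k + r) \<in> (Z \<inter> bounded_exps l) \<times> multiple_exps l \<rightarrow> Z"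
    by (auto simp: Z_closed)
  have "exp_mod l m \<in> Z" if "m \<in> Z" for m
    using that Z_closed[OF minus_exp_mod_in_multiple_exps, of m "exp_mod l m"]
    by (simp add: minus_exp_mod_add)
  then show "(\<lambda>m. (exp_mod l m, m - exp_mod l m)) \<in> Z \<rightarrow> (Z \<inter> bounded_exps l) \<times> multiple_exps l"
    by (simp add: minus_exp_mod_in_multiple_exps exp_mod_in_bounded_exps l_pos)
qed (auto simp: minus_exp_mod_add exp_mod_add_multiple)

lemma primary_multiplicities_iff:
  "primary_multiplicities G q l \<longleftrightarrow>
    (\<forall>v. 0 < l v \<and> single v (l v) \<in> class_exps G q \<one>\<^bsub>Jac G\<^esub>)"
  by (simp add: primary_multiplicities_def ord_q_dvd_iff class_exps_def)

lemma primary_invariants_pure_powers: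
  assumes conn: "connected_multigraph G" and primary: "primary_multiplicities G q l"
  shows "primary_invariants (Jac_Gamma G q) (pure_powers l)"
proof -
  let ?Z = "class_exps G q \<one>\<^bsub>Jac G\<^esub>"
  have pos: "0 < l v" and inv: "single v (l v) \<in> ?Z" for v
    using primary by (auto simp: primary_multiplicities_iff)
  have "multiple_exps l \<subseteq> ?Z"
    unfolding range_exp_comb_singles[symmetric] exp_comb_def
    by (auto intro!: sum_in_class_exps_one inv)
  then have "bij_betw (\<lambda>(r, k). k + r) ((?Z \<inter> bounded_exps l) \<times> multiple_exps l) ?Z"
    by (intro bij_betw_exp_division pos add_in_class_exps_iff) auto
  then have "fin_free_module (gen_subalgebra (pure_powers l)) (supported_on ?Z)"
    unfolding gen_subalgebra_monomials range_exp_comb_singles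
    by (rule fin_free_module_supported_on[rotated 2])
      (auto intro: finite_bounded_exps finite_subset)
  moreover have "alg_independent (pure_powers l)"
    by (intro alg_independent_monomials inj_exp_comb_singles pos)
  ultimately show ?thesis
    using inv
    by (simp add: primary_invariants_def invariants_eq_supported_on[OF conn] homogeneous_monomial
        monomial_in_supported_on_iff)
qed

lemma fin_free_module_pure_powerE:
  fixes g :: "'v::finite \<Rightarrow> 'v \<Rightarrow>\<^sub>0 nat"
  assumes free: "fin_free_module (gen_subalgebra (\<lambda>v. monomial (g v))) M"
    and inf: "infinite {j. monomial (single u j) \<in> M}"
  obtains v j where "0 < j" "g v = single u j"
proof -
  obtain B where "finite B"
    and bij: "bij_betw (\<lambda>a. \<Sum>b\<in>B. a b * b) (B \<rightarrow>\<^sub>E supported_on (range (exp_comb g))) M"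
    using free by (auto simp: fin_free_module_def gen_subalgebra_monomials)
  have "\<exists>a. (\<forall>b\<in>B. a b \<in> supported_on (range (exp_comb g))) \<and>
      monomial (single u j) = (\<Sum>b\<in>B. a b * b)" if "monomial (single u j) \<in> M" for j
    using that unfolding bij_betw_imp_surj_on[OF bij, symmetric] by blast
  then have "\<exists>i>0. single u i \<in> range (exp_comb g)"
    by (intro pure_power_in_generated_exps[OF \<open>finite B\<close> inf]) simp
  then obtain i m where "single u i = exp_comb g m" "0 < i" by blast
  then show ?thesis by (rule pure_power_exp_combE) (rule that)
qed

lemma range_pure_powersE:
  fixes g :: "'v::finite \<Rightarrow> 'v \<Rightarrow>\<^sub>0 nat"
  assumes "\<And>u. \<exists>v j. 0 < j \<and> g v = single u j"
  obtains l where "\<And>u. 0 < l u" "range g = range (\<lambda>u. single u (l u))"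
proof -
  obtain s l where l_pos: "\<And>u. 0 < l u" and g_s: "\<And>u. g (s u) = single u (l u)"
    using assms by metis
  have "inj s"
  proof (rule injI)
    fix u w assume "s u = s w"
    then have "single u (l u) = single w (l w)" by (metis g_s)
    then have "lookup (single w (l w)) u = l u" by (metis lookup_single_eq)
    then show "u = w" using l_pos[of u] by (auto simp: lookup_single when_def split: if_splits)
  qed
  then have "range s = UNIV" by (rule finite_UNIV_inj_surj[OF finite])
  then have "range g = g ` range s" by simp
  then have "range g = range (\<lambda>u. single u (l u))" by (simp add: image_image g_s)
  with l_pos show ?thesis by (rule that)
qed

lemma infinite_pure_powers_in_class_exps_one:
  assumes "connected_multigraph G"
  shows "infinite {j. single u j \<in> class_exps G q \<one>\<^bsub>Jac G\<^esub>}"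
proof (rule infinite_super)
  show "range (\<lambda>k. ord_q G q u * k) \<subseteq> {j. single u j \<in> class_exps G q \<one>\<^bsub>Jac G\<^esub>}"
    by (auto simp: class_exps_def simp flip: ord_q_dvd_iff)
  show "infinite (range (\<lambda>k. ord_q G q u * k))"
    using ord_q_pos[OF assms, of q u] by (intro range_inj_infinite) (simp add: inj_def)
qed

lemma primary_invariants_monomialE:
  fixes G :: "'v::finite multigraph"
  assumes conn: "connected_multigraph G" and primary: "primary_invariants (Jac_Gamma G q) p"
    and mon: "range p \<subseteq> monomials"
  obtains l where "primary_multiplicities G q l" "range p = range (pure_powers l)"
proof -
  let ?Z = "class_exps G q \<one>\<^bsub>Jac G\<^esub>"
  have "\<forall>v. \<exists>m. p v = monomial m" using mon by (auto simp: monomials_eq_range)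
  then obtain g where p_eq: "p = (\<lambda>v. monomial (g v))" by metis
  have inv: "range g \<subseteq> ?Z"
    and free: "fin_free_module (gen_subalgebra (\<lambda>v. monomial (g v))) (supported_on ?Z)"
    using primary by (auto simp: primary_invariants_def invariants_eq_supported_on[OF conn] p_eq
        monomial_in_supported_on_iff)
  have "\<exists>v j. 0 < j \<and> g v = single u j" for u
    using fin_free_module_pure_powerE[OF free] infinite_pure_powers_in_class_exps_one[OF conn]
    unfolding monomial_in_supported_on_iff by metis
  then obtain l where l_pos: "\<And>u. 0 < l u" and range_g: "range g = range (\<lambda>u. single u (l u))"
    using range_pure_powersE by blast
  have "primary_multiplicities G q l"
    using l_pos inv unfolding range_g primary_multiplicities_iff by blast
  moreover have "range p = monomial ` range g" by (simp add: p_eq image_image)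
  then have "range p = range (pure_powers l)" unfolding range_g by (simp add: image_image)
  ultimately show ?thesis by (rule that)
qed

lemma range_primary_invariants_eq:
  assumes "connected_multigraph G"
  shows "{range p | p. primary_invariants (Jac_Gamma G q) p \<and> range p \<subseteq> monomials} =
    {range (pure_powers l) | l. primary_multiplicities G q l}" (is "?L = ?R")
proof (intro equalityI subsetI)
  fix X assume "X \<in> ?L"
  then obtain p where primary: "primary_invariants (Jac_Gamma G q) p" "range p \<subseteq> monomials"
    and X_eq: "X = range p"
    by blast
  obtain l where "primary_multiplicities G q l" "range p = range (pure_powers l)"
    using primary_invariants_monomialE[OF assms primary] .
  then show "X \<in> ?R" using X_eq by blast
next
  fix X assume "X \<in> ?R"
  then obtain l where primary: "primary_multiplicities G q l" and X_eq: "X = range (pure_powers l)"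
    by blast
  have "primary_invariants (Jac_Gamma G q) (pure_powers l)"
    by (rule primary_invariants_pure_powers[OF assms primary])
  moreover have "range (pure_powers l) \<subseteq> monomials" by (auto simp: monomials_eq_range)
  ultimately show "X \<in> ?L" unfolding X_eq by (intro CollectI exI[of _ "pure_powers l"]) simp
qed

subsection \<open>Secondary invariants\<close>

lemma ideal_monomials:
  fixes g :: "'v::finite \<Rightarrow> 'v \<Rightarrow>\<^sub>0 nat"
  shows "{\<Sum>v\<in>UNIV. monomial (g v) * h v | h. \<forall>v. h v \<in> supported_on C} =
    (supported_on (\<Union>k\<in>range g. (\<lambda>m. m + k) ` C) :: 'v cpoly set)"
proof -
  have UN_range: "(\<Union>k\<in>range g. (\<lambda>m. m + k) ` C) = (\<Union>v. (\<lambda>m. m + g v) ` C)" by blast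
  have commute: "(\<Sum>v\<in>UNIV. monomial (g v) * h v) = (\<Sum>v\<in>UNIV. h v * monomial (g v))"
    for h :: "'v \<Rightarrow> 'v cpoly"
    by (intro sum.cong refl mult.commute)
  show ?thesis
    unfolding commute UN_range
    by (auto intro: sum_shift_in_supported_on elim!: supported_on_UN_shiftE[OF finite])
qed

lemma UN_shift_singles:
  fixes l :: "'v::finite \<Rightarrow> nat"
  assumes "\<And>v m. single v (l v) + m \<in> C \<longleftrightarrow> m \<in> C"
  shows "(\<Union>k\<in>range (\<lambda>v. single v (l v)). (\<lambda>m. m + k) ` C) = C - bounded_exps l"
proof (intro equalityI subsetI)
  fix m assume m_in: "m \<in> C - bounded_exps l"
  then obtain v where l_le: "l v \<le> lookup m v" by (auto simp: bounded_exps_def not_less)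
  have "m = (m - single v (l v)) + single v (l v)"
    by (rule poly_mapping_eqI)
      (use l_le in \<open>auto simp: lookup_add lookup_minus lookup_single when_def\<close>)
  then obtain k where m_eq: "m = k + single v (l v)" by blast
  then have "k \<in> C" using m_in assms by (simp add: add.commute[of k])
  with m_eq show "m \<in> (\<Union>k\<in>range (\<lambda>v. single v (l v)). (\<lambda>m. m + k) ` C)" by blast
next
  fix m assume "m \<in> (\<Union>k\<in>range (\<lambda>v. single v (l v)). (\<lambda>m. m + k) ` C)"
  then obtain v k where m_eq: "m = k + single v (l v)" and k_in: "k \<in> C" by blast
  have "l v \<le> lookup m v" by (simp add: m_eq lookup_add)
  then have "m \<notin> bounded_exps l" by (auto simp: bounded_exps_def not_less)
  then show "m \<in> C - bounded_exps l" using assms k_in m_eq by (simp add: add.commute[of k])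
qed

lemma secondary_invariants_iff:
  fixes G :: "'v::finite multigraph"
  assumes conn: "connected_multigraph G" and c_in: "c \<in> carrier (Jac G)"
    and primary: "primary_multiplicities G q l"
    and range_p: "range p = range (pure_powers l)" and Q_monomials: "Q \<subseteq> monomials"
  shows "secondary_invariants (Jac_Gamma G q) (jac_char G q c) p Q \<longleftrightarrow>
    Q = monomial ` (class_exps G q c \<inter> bounded_exps l)"
proof -
  let ?C = "class_exps G q c"
  have "range p \<subseteq> range monomial" unfolding range_p by auto
  then have "\<forall>v. \<exists>m. p v = monomial m" by auto
  then obtain g where p_eq: "p = (\<lambda>v. monomial (g v))" by metis
  have "monomial ` range g = (monomial ` range (\<lambda>v. single v (l v)) :: 'v cpoly set)"
    using range_p by (simp add: p_eq image_image)
  then have "range g = range (\<lambda>v. single v (l v))"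
    unfolding inj_image_eq_iff[OF inj_monomial] .
  moreover have "single v (l v) + m \<in> ?C \<longleftrightarrow> m \<in> ?C" for m v
    using primary by (intro add_in_class_exps_iff) (simp add: primary_multiplicities_iff)
  ultimately have ideal: "{\<Sum>v\<in>UNIV. p v * h v | h. \<forall>v. h v \<in> supported_on ?C} =
      supported_on (?C - bounded_exps l)"
    by (simp only: p_eq ideal_monomials UN_shift_singles)
  have double_diff: "?C - (?C - bounded_exps l) = ?C \<inter> bounded_exps l" by blast
  have "basis_modulo Q (supported_on ?C) (supported_on (?C - bounded_exps l)) \<longleftrightarrow>
      Q = monomial ` (?C \<inter> bounded_exps l)"
    using basis_modulo_supported_on_iff[of ?C "?C - bounded_exps l" Q] Q_monomials
    by (simp add: double_diff finite_bounded_exps monomials_eq_range)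
  moreover have "\<forall>f\<in>Q. homogeneous_poly f"
    using Q_monomials homogeneous_monomial by (auto simp: monomials_eq_range)
  ultimately show ?thesis
    by (simp add: secondary_invariants_def rel_invariants_eq_supported_on[OF conn c_in] ideal)
qed

lemma primary_secondary_invariants_eq:
  assumes conn: "connected_multigraph G" and c_in: "c \<in> carrier (Jac G)"
  shows "{(range p, Q) | p Q. primary_invariants (Jac_Gamma G q) p \<and> range p \<subseteq> monomials \<and>
      secondary_invariants (Jac_Gamma G q) (jac_char G q c) p Q \<and> Q \<subseteq> monomials} =
    {(range (pure_powers l), monomial ` (class_exps G q c \<inter> bounded_exps l)) | l.
      primary_multiplicities G q l}" (is "?L = ?R")
proof (intro equalityI subsetI)
  fix X assume "X \<in> ?L"
  then obtain p Q where X_eq: "X = (range p, Q)"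
    and primary_p: "primary_invariants (Jac_Gamma G q) p" "range p \<subseteq> monomials"
    and secondary_Q: "secondary_invariants (Jac_Gamma G q) (jac_char G q c) p Q" "Q \<subseteq> monomials"
    by blast
  obtain l where primary_l: "primary_multiplicities G q l"
    and range_p: "range p = range (pure_powers l)"
    using primary_invariants_monomialE[OF conn primary_p] .
  have "Q = monomial ` (class_exps G q c \<inter> bounded_exps l)"
    using secondary_invariants_iff[OF conn c_in primary_l range_p secondary_Q(2)] secondary_Q(1)
    by blast
  then show "X \<in> ?R" using X_eq primary_l range_p by blast
next
  fix X assume "X \<in> ?R"
  then obtain l where primary_l: "primary_multiplicities G q l"
    and X_eq: "X = (range (pure_powers l), monomial ` (class_exps G q c \<inter> bounded_exps l))"
    by blast
  have mon: "monomial ` (class_exps G q c \<inter> bounded_exps l) \<subseteq> monomials"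
    "range (pure_powers l) \<subseteq> monomials"
    by (auto simp: monomials_eq_range)
  moreover have "secondary_invariants (Jac_Gamma G q) (jac_char G q c) (pure_powers l)
      (monomial ` (class_exps G q c \<inter> bounded_exps l))"
    using secondary_invariants_iff[OF conn c_in primary_l refl mon(1)] by simp
  moreover have "primary_invariants (Jac_Gamma G q) (pure_powers l)"
    by (rule primary_invariants_pure_powers[OF conn primary_l])
  ultimately show "X \<in> ?L" unfolding X_eq
    by (intro CollectI exI[of _ "pure_powers l"]
        exI[of _ "monomial ` (class_exps G q c \<inter> bounded_exps l)"]) simp
qed

subsection \<open>The correspondence between divisors and invariants\<close>

lemma primary_divisors_eq_image: "primary_divisors l = exp_divisor ` range (\<lambda>v. single v (l v))"
  by (simp add: primary_divisors_def image_image exp_divisor_single)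

lemma secondary_divisors_eq_image:
  assumes "div_degree D = 0"
  shows "secondary_divisors G q D l =
    exp_divisor ` (class_exps G q (jac_class G D) \<inter> bounded_exps l)"
  by (auto simp: secondary_divisors_def effective_class_eq_image[OF assms] bounded_exps_def
      exp_divisor_def)

lemma div_monomial_primary_divisors: "div_monomial ` primary_divisors l = range (pure_powers l)"
  by (simp add: primary_divisors_eq_image image_image div_monomial_exp_divisor)

lemma div_monomial_secondary_divisors:
  assumes "div_degree D = 0"
  shows "div_monomial ` secondary_divisors G q D l =
    monomial ` (class_exps G q (jac_class G D) \<inter> bounded_exps l)"
  by (simp add: secondary_divisors_eq_image[OF assms] div_monomial_image_exp_divisor)

lemma bij_betw_primary_divisors:
  assumes "connected_multigraph G"
  shows "bij_betw (\<lambda>P. div_monomial ` P)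
    {primary_divisors l | l. primary_multiplicities G q l}
    {range p | p. primary_invariants (Jac_Gamma G q) p \<and> range p \<subseteq> monomials}"
  unfolding range_primary_invariants_eq[OF assms]
proof (rule bij_betw_imageI)
  show "inj_on (\<lambda>P. div_monomial ` P) {primary_divisors l | l. primary_multiplicities G q l}"
    by (rule inj_on_subset[OF inj_on_image_Pow[OF inj_on_div_monomial]])
      (auto simp: primary_divisors_eq_image effective_exp_divisor)
qed (simp add: setcompr_eq_image image_image div_monomial_primary_divisors)

lemma bij_betw_primary_secondary_divisors:
  fixes D :: "'v::finite divisor"
  assumes conn: "connected_multigraph G" and deg_D: "div_degree D = 0"
  shows "bij_betw (\<lambda>(P, S). (div_monomial ` P, div_monomial ` S))
    {(primary_divisors l, secondary_divisors G q D l) | l. primary_multiplicities G q l}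
    {(range p, Q) | p Q. primary_invariants (Jac_Gamma G q) p \<and> range p \<subseteq> monomials \<and>
      secondary_invariants (Jac_Gamma G q) (jac_char G q (jac_class G D)) p Q \<and> Q \<subseteq> monomials}"
  unfolding primary_secondary_invariants_eq[OF conn jac_class_in_carrier[OF deg_D]]
proof (rule bij_betw_imageI)
  let ?E = "{E :: 'v divisor. effective E}"
  have "inj_on (map_prod ((`) div_monomial) ((`) div_monomial)) (Pow ?E \<times> Pow ?E)"
    by (intro map_prod_inj_on inj_on_image_Pow inj_on_div_monomial)
  then show "inj_on (\<lambda>(P, S). (div_monomial ` P, div_monomial ` S))
      {(primary_divisors l, secondary_divisors G q D l) | l. primary_multiplicities G q l}"
    unfolding map_prod_def
    by (rule inj_on_subset)
      (auto simp: primary_divisors_eq_image secondary_divisors_eq_image[OF deg_D]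
        effective_exp_divisor)
qed (simp add: setcompr_eq_image image_image div_monomial_primary_divisors
    div_monomial_secondary_divisors[OF deg_D])

theorem theorem5p1:
  fixes G :: "'v::finite multigraph" and q :: 'v
  assumes "connected_multigraph G"
  shows
    "(\<forall>D. div_degree D = 0 \<longrightarrow>
        cpoly.independent (div_monomial ` effective_class G q D) \<and>
        cpoly.span (div_monomial ` effective_class G q D) =
          rel_invariants (Jac_Gamma G q) (jac_char G q (jac_class G D))) \<and>
     (\<forall>f :: 'v cpoly. \<exists>!h.
        h \<in> (\<Pi>\<^sub>E c\<in>carrier (Jac G). rel_invariants (Jac_Gamma G q) (jac_char G q c)) \<and>
        f = (\<Sum>c\<in>carrier (Jac G). h c)) \<and>
     bij_betw (\<lambda>P. div_monomial ` P)
       {primary_divisors l | l. primary_multiplicities G q l}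
       {range p | p. primary_invariants (Jac_Gamma G q) p \<and> range p \<subseteq> monomials} \<and>
     (\<forall>D. div_degree D = 0 \<longrightarrow>
        bij_betw (\<lambda>(P, S). (div_monomial ` P, div_monomial ` S))
          {(primary_divisors l, secondary_divisors G q D l) | l. primary_multiplicities G q l}
          {(range p, Q) | p Q.
             primary_invariants (Jac_Gamma G q) p \<and> range p \<subseteq> monomials \<and>
             secondary_invariants (Jac_Gamma G q) (jac_char G q (jac_class G D)) p Q \<and>
             Q \<subseteq> monomials})"
proof (intro conjI allI impI)
  fix D :: "'v divisor" assume "div_degree D = 0"
  then show "cpoly.independent (div_monomial ` effective_class G q D)"
    by (rule independent_monomials_effective_class)
  show "cpoly.span (div_monomial ` effective_class G q D) =
      rel_invariants (Jac_Gamma G q) (jac_char G q (jac_class G D))"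
    using assms \<open>div_degree D = 0\<close> by (rule span_monomials_effective_class)
qed (rule direct_sum_rel_invariants[OF assms], rule bij_betw_primary_divisors[OF assms],
  rule bij_betw_primary_secondary_divisors[OF assms])

end
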